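(* Let $p,q\in(0,1)$, and let $\sigma_p$ and $\sigma_q$ be irreducible finite-dimensional unitary representations of the stabilizers $F_p$ and $F_q$, respectively, of the points $p$ and $q$ in Thompson's group $F$. Then the induced representations $\mathrm{Ind}_{F_p}^F\sigma_p$ and $\mathrm{Ind}_{F_q}^F\sigma_q$ are irreducible. Moreover, they are equivalent if and only if there exists $\gamma\in F$ such that $q=\gamma(p)$ and $\sigma_p$ is equivalent to $\sigma_q^\gamma$, where $\sigma_q^\gamma$ is the representation of $F_p$ given by $\sigma_q^\gamma(x)=\sigma_q(\gamma x\gamma^{-1})$ (note that $F_q=\gamma F_p\gamma^{-1}$).
   Context: Thompson's group $F$ consists of all orientation-preserving piecewise linear homeomorphisms $\phi$ of the unit interval $[0,1]$ such that (1) $\phi$ preserves the set $\mathbb{Z}[1/2]\cap[0,1]$ of dyadic rationals in $[0,1]$; (2) $\phi$ has finitely many nondifferentiability points, all lying in $\mathbb{Z}[1/2]$; (3) the slopes of $\phi$ are of the form $2^k$, $k\in\mathbb{Z}$. $F$ is regarded as a discrete group. For $p\in(0,1)$, $F_p=\{\gamma\in F:\gamma(p)=p\}$. For a subgroup $H$ of a discrete group $G$ and a unitary representation $\sigma$ of $H$, $\mathrm{Ind}_H^G\sigma$ denotes the usual unitarily induced ($\ell^2$) representation of $G$. Equivalence means unitary equivalence. *)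

theory Defs
  imports
    "HOL-Analysis.Analysis"
    "HOL-Algebra.Bij"
    "HOL-Algebra.Coset"
    "HOL-Library.Function_Algebras"
begin

section \<open>Complex Hilbert spaces\<close>

class complex_vector = ab_group_add +
  fixes scaleC :: "complex \<Rightarrow> 'a \<Rightarrow> 'a"
  assumes scaleC_add_right: "scaleC c (x + y) = scaleC c x + scaleC c y"
    and scaleC_add_left: "scaleC (c + d) x = scaleC c x + scaleC d x"
    and scaleC_scaleC: "scaleC c (scaleC d x) = scaleC (c * d) x"
    and scaleC_one: "scaleC 1 x = x"

global_interpretation cvec: vector_space "scaleC :: complex \<Rightarrow> 'a \<Rightarrow> 'a::complex_vector"
  by unfold_locales (rule scaleC_add_right scaleC_add_left scaleC_scaleC scaleC_one)+

instantiation complex :: complex_vector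
begin

definition "scaleC c (z::complex) = c * z"

instance
  by standard (simp_all add: scaleC_complex_def algebra_simps)

end

instantiation "fun" :: (type, complex_vector) complex_vector
begin

definition "scaleC c f = (\<lambda>x. scaleC c (f x))"

instance
  by standard (simp_all add: scaleC_fun_def fun_eq_iff scaleC_add_right scaleC_add_left
      scaleC_scaleC scaleC_one)

end

text \<open>
  The carrier of a Hilbert space is a linear subspace of an ambient complex vector space (a type),
  which need not itself carry an inner product. The inner product is linear in the first argument.
\<close>

record 'v hspace = "'v partial_object" +
  cinner :: "'v \<Rightarrow> 'v \<Rightarrow> complex"

definition hnorm :: "('v, 'x) hspace_scheme \<Rightarrow> 'v \<Rightarrow> real" where
  "hnorm V x = sqrt (Re (cinner V x x))"

text \<open>The value outside the carrier is irrelevant; the library's metric spaces require a distance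
  that is symmetric on the whole type.\<close>

definition hdist :: "('v::complex_vector, 'x) hspace_scheme \<Rightarrow> 'v \<Rightarrow> 'v \<Rightarrow> real" where
  "hdist V x y = (if x \<in> carrier V \<and> y \<in> carrier V then hnorm V (x - y) else 0)"

locale pre_hilbert_space =
  fixes V :: "('v::complex_vector, 'x) hspace_scheme"
  assumes subspace_carrier: "cvec.subspace (carrier V)"
    and cinner_add_left: "\<lbrakk>x \<in> carrier V; y \<in> carrier V; z \<in> carrier V\<rbrakk>
          \<Longrightarrow> cinner V (x + y) z = cinner V x z + cinner V y z"
    and cinner_scaleC_left: "\<lbrakk>x \<in> carrier V; y \<in> carrier V\<rbrakk>
          \<Longrightarrow> cinner V (scaleC c x) y = c * cinner V x y"
    and cinner_commute: "\<lbrakk>x \<in> carrier V; y \<in> carrier V\<rbrakk>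
          \<Longrightarrow> cinner V x y = cnj (cinner V y x)"
    and cinner_pos: "\<lbrakk>x \<in> carrier V; x \<noteq> 0\<rbrakk> \<Longrightarrow> 0 < Re (cinner V x x)"
begin

lemma carrier_closed:
  shows zero_carrier: "0 \<in> carrier V"
    and add_carrier: "x \<in> carrier V \<Longrightarrow> y \<in> carrier V \<Longrightarrow> x + y \<in> carrier V"
    and diff_carrier: "x \<in> carrier V \<Longrightarrow> y \<in> carrier V \<Longrightarrow> x - y \<in> carrier V"
    and scaleC_carrier: "x \<in> carrier V \<Longrightarrow> scaleC c x \<in> carrier V"
  using subspace_carrier
  by (auto intro: cvec.subspace_0 cvec.subspace_add cvec.subspace_diff cvec.subspace_scale)

lemma cinner_add_right:
  "\<lbrakk>x \<in> carrier V; y \<in> carrier V; z \<in> carrier V\<rbrakk>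
    \<Longrightarrow> cinner V x (y + z) = cinner V x y + cinner V x z"
  by (metis add_carrier cinner_add_left cinner_commute complex_cnj_add)

lemma cinner_scaleC_right:
  "\<lbrakk>x \<in> carrier V; y \<in> carrier V\<rbrakk> \<Longrightarrow> cinner V x (scaleC c y) = cnj c * cinner V x y"
  by (metis scaleC_carrier cinner_scaleC_left cinner_commute complex_cnj_mult)

lemma cinner_zero_left: "x \<in> carrier V \<Longrightarrow> cinner V 0 x = 0"
  using cinner_scaleC_left[of 0 x 0] zero_carrier by simp

lemma cinner_nonneg: "x \<in> carrier V \<Longrightarrow> 0 \<le> Re (cinner V x x)"
  using cinner_pos[of x] cinner_zero_left[of 0] zero_carrier by (cases "x = 0") auto

lemma hnorm_nonneg: "x \<in> carrier V \<Longrightarrow> 0 \<le> hnorm V x"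
  by (simp add: hnorm_def cinner_nonneg)

lemma hnorm_eq_0_iff: "x \<in> carrier V \<Longrightarrow> hnorm V x = 0 \<longleftrightarrow> x = 0"
  using cinner_pos[of x] cinner_zero_left[of 0] zero_carrier by (fastforce simp: hnorm_def)

lemma hnorm_scaleC: "x \<in> carrier V \<Longrightarrow> hnorm V (scaleC c x) = cmod c * hnorm V x"
proof -
  assume x: "x \<in> carrier V"
  have "cinner V (scaleC c x) (scaleC c x) = (c * cnj c) * cinner V x x"
    by (simp add: x cinner_scaleC_left cinner_scaleC_right scaleC_carrier)
  also have "c * cnj c = complex_of_real ((cmod c)\<^sup>2)"
    by (simp only: complex_norm_square)
  finally show ?thesis
    by (simp add: hnorm_def real_sqrt_mult)
qed

lemma Re_cinner_bound:
  assumes x: "x \<in> carrier V" and y: "y \<in> carrier V"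
  shows "Re (cinner V x y) \<le> hnorm V x * hnorm V y"
proof (cases "x = 0 \<or> y = 0")
  case True
  then have "cinner V x y = 0"
    using x y cinner_zero_left cinner_commute[of x y] by auto
  then show ?thesis
    using x y by (simp add: hnorm_nonneg)
next
  case False
  define a where "a = hnorm V x"
  define b where "b = hnorm V y"
  have a0: "0 < a" and b0: "0 < b"
    using False x y hnorm_nonneg hnorm_eq_0_iff by (auto simp: a_def b_def less_le)
  have aa: "Re (cinner V x x) = a\<^sup>2" and bb: "Re (cinner V y y) = b\<^sup>2"
    using x y by (simp_all add: a_def b_def hnorm_def cinner_nonneg)
  have yx: "Re (cinner V y x) = Re (cinner V x y)"
    using cinner_commute[OF x y] by simp
  define z where "z = scaleC (of_real b) x + scaleC (of_real (- a)) y"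
  have bx: "scaleC (of_real b) x \<in> carrier V" and ay: "scaleC (of_real (- a)) y \<in> carrier V"
    by (rule scaleC_carrier[OF x], rule scaleC_carrier[OF y])
  have "cinner V z z = of_real (b * b) * cinner V x x - of_real (b * a) * cinner V x y
      - of_real (a * b) * cinner V y x + of_real (a * a) * cinner V y y"
    unfolding z_def
    by (simp add: cinner_add_left cinner_add_right cinner_scaleC_left cinner_scaleC_right
        bx ay x y add_carrier scaleC_carrier del: of_real_minus) (simp add: algebra_simps)
  then have "Re (cinner V z z) = b * b * a\<^sup>2 - b * a * Re (cinner V x y)
      - a * b * Re (cinner V x y) + a * a * b\<^sup>2"
    by (simp add: aa bb yx)
  moreover have "0 \<le> Re (cinner V z z)"
    unfolding z_def by (intro cinner_nonneg add_carrier bx ay)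
  ultimately have "0 \<le> (2 * (a * b)) * (a * b - Re (cinner V x y))"
    by (simp add: algebra_simps power2_eq_square)
  then have "0 \<le> a * b - Re (cinner V x y)"
    using a0 b0 by (simp only: zero_le_mult_iff) (use mult_pos_pos[OF a0 b0] in linarith)
  then show ?thesis
    by (simp add: a_def b_def)
qed

lemma hnorm_triangle:
  assumes x: "x \<in> carrier V" and y: "y \<in> carrier V"
  shows "hnorm V (x + y) \<le> hnorm V x + hnorm V y"
proof -
  have yx: "Re (cinner V y x) = Re (cinner V x y)"
    using cinner_commute[OF x y] by simp
  have "Re (cinner V (x + y) (x + y))
      = Re (cinner V x x) + 2 * Re (cinner V x y) + Re (cinner V y y)"
    by (simp add: cinner_add_left cinner_add_right x y add_carrier yx)
  also have "\<dots> \<le> (hnorm V x)\<^sup>2 + 2 * (hnorm V x * hnorm V y) + (hnorm V y)\<^sup>2"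
    using Re_cinner_bound[OF x y] x y by (simp add: hnorm_def cinner_nonneg)
  also have "\<dots> = (hnorm V x + hnorm V y)\<^sup>2"
    by (simp add: power2_sum)
  finally have "hnorm V (x + y) \<le> sqrt ((hnorm V x + hnorm V y)\<^sup>2)"
    unfolding hnorm_def[of V "x + y"] by (rule real_sqrt_le_mono)
  then show ?thesis
    using hnorm_nonneg[OF x] hnorm_nonneg[OF y] by simp
qed

sublocale Metric_space "carrier V" "hdist V"
proof
  show "0 \<le> hdist V x y" for x y
    by (simp add: hdist_def hnorm_nonneg diff_carrier)
  show "hdist V x y = hdist V y x" for x y
  proof (cases "x \<in> carrier V \<and> y \<in> carrier V")
    case True
    then have "hnorm V (scaleC (- 1) (x - y)) = hnorm V (x - y)"
      by (simp only: hnorm_scaleC diff_carrier norm_minus_cancel norm_one mult_1)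
    moreover have "scaleC (- 1) (x - y) = y - x"
      by (simp only: cvec.scale_minus_left scaleC_one minus_diff_eq)
    ultimately show ?thesis
      using True by (simp add: hdist_def)
  qed (auto simp: hdist_def)
  show "hdist V x y = 0 \<longleftrightarrow> x = y" if "x \<in> carrier V" "y \<in> carrier V" for x y
    using that by (simp add: hdist_def hnorm_eq_0_iff diff_carrier)
  show "hdist V x z \<le> hdist V x y + hdist V y z"
    if "x \<in> carrier V" "y \<in> carrier V" "z \<in> carrier V" for x y z
    using that hnorm_triangle[of "x - y" "y - z"] by (simp add: hdist_def diff_carrier)
qed

end

locale hilbert_space = pre_hilbert_space +
  assumes complete: "mcomplete"

definition finite_dimensional :: "('v::complex_vector, 'x) hspace_scheme \<Rightarrow> bool" where
  "finite_dimensional V \<longleftrightarrow> (\<exists>B. finite B \<and> cvec.span B = carrier V)"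

definition closed_subspace :: "('v::complex_vector, 'x) hspace_scheme \<Rightarrow> 'v set \<Rightarrow> bool" where
  "closed_subspace V W \<longleftrightarrow>
     cvec.subspace W \<and> closedin (Metric_space.mtopology (carrier V) (hdist V)) W"

definition unitary_map ::
    "('v::complex_vector, 'x) hspace_scheme \<Rightarrow> ('w::complex_vector, 'y) hspace_scheme
      \<Rightarrow> ('v \<Rightarrow> 'w) \<Rightarrow> bool" where
  "unitary_map V W U \<longleftrightarrow>
     bij_betw U (carrier V) (carrier W) \<and>
     (\<forall>x\<in>carrier V. \<forall>y\<in>carrier V. U (x + y) = U x + U y) \<and>
     (\<forall>c. \<forall>x\<in>carrier V. U (scaleC c x) = scaleC c (U x)) \<and>
     (\<forall>x\<in>carrier V. \<forall>y\<in>carrier V. cinner W (U x) (U y) = cinner V x y)"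

section \<open>Unitary representations of discrete groups\<close>

definition unitary_group :: "('v::complex_vector, 'x) hspace_scheme \<Rightarrow> ('v \<Rightarrow> 'v) monoid" where
  "unitary_group V =
     BijGroup (carrier V)\<lparr>carrier := {U \<in> Bij (carrier V). unitary_map V V U}\<rparr>"

definition unitary_rep ::
    "('g, 'x) monoid_scheme \<Rightarrow> ('v::complex_vector, 'y) hspace_scheme
      \<Rightarrow> ('g \<Rightarrow> 'v \<Rightarrow> 'v) \<Rightarrow> bool" where
  "unitary_rep G V \<pi> \<longleftrightarrow> hilbert_space V \<and> \<pi> \<in> hom G (unitary_group V)"

definition irreducible_rep ::
    "('g, 'x) monoid_scheme \<Rightarrow> ('v::complex_vector, 'y) hspace_scheme
      \<Rightarrow> ('g \<Rightarrow> 'v \<Rightarrow> 'v) \<Rightarrow> bool" where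
  "irreducible_rep G V \<pi> \<longleftrightarrow>
     unitary_rep G V \<pi> \<and> carrier V \<noteq> {0} \<and>
     (\<forall>W. closed_subspace V W \<and> (\<forall>g\<in>carrier G. \<pi> g ` W \<subseteq> W) \<longrightarrow> W = {0} \<or> W = carrier V)"

definition equivalent_reps ::
    "('g, 'x) monoid_scheme
      \<Rightarrow> ('v::complex_vector, 'y) hspace_scheme \<Rightarrow> ('g \<Rightarrow> 'v \<Rightarrow> 'v)
      \<Rightarrow> ('w::complex_vector, 'z) hspace_scheme \<Rightarrow> ('g \<Rightarrow> 'w \<Rightarrow> 'w) \<Rightarrow> bool" where
  "equivalent_reps G V \<pi> W \<rho> \<longleftrightarrow>
     (\<exists>U. unitary_map V W U \<and> (\<forall>g\<in>carrier G. \<forall>v\<in>carrier V. U (\<pi> g v) = \<rho> g (U v)))"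

text \<open>
  The induced representation acts by right translation on the square-summable functions
  \<open>f\<close> on \<open>G\<close> with \<open>f (h x) = \<sigma> h (f x)\<close> for \<open>h \<in> H\<close>. As \<open>\<sigma>\<close> is unitary, \<open>\<langle>f x, k x\<rangle>\<close> depends
  only on the right coset \<open>H x\<close>, so the choice of coset representatives below is immaterial.
  Functions are set to \<open>0\<close> outside \<open>carrier G\<close>, so that they form a vector space under
  pointwise operations.
\<close>

definition coset_rep :: "'g set \<Rightarrow> 'g" where
  "coset_rep C = (SOME x. x \<in> C)"

definition ind_space ::
    "('g, 'x) monoid_scheme \<Rightarrow> 'g set \<Rightarrow> ('v::complex_vector, 'y) hspace_scheme
      \<Rightarrow> ('g \<Rightarrow> 'v \<Rightarrow> 'v) \<Rightarrow> ('g \<Rightarrow> 'v) hspace" where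
  "ind_space G H V \<sigma> =
     \<lparr>carrier = {f. (\<forall>x. x \<notin> carrier G \<longrightarrow> f x = 0) \<and>
                    (\<forall>x\<in>carrier G. f x \<in> carrier V) \<and>
                    (\<forall>h\<in>H. \<forall>x\<in>carrier G. f (h \<otimes>\<^bsub>G\<^esub> x) = \<sigma> h (f x)) \<and>
                    (\<lambda>C. (hnorm V (f (coset_rep C)))\<^sup>2) summable_on (rcosets\<^bsub>G\<^esub> H)},
      cinner = (\<lambda>f k. \<Sum>\<^sub>\<infinity>C\<in>rcosets\<^bsub>G\<^esub> H. cinner V (f (coset_rep C)) (k (coset_rep C)))\<rparr>"

definition ind_rep ::
    "('g, 'x) monoid_scheme \<Rightarrow> 'g set \<Rightarrow> ('v::complex_vector, 'y) hspace_scheme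
      \<Rightarrow> ('g \<Rightarrow> 'v \<Rightarrow> 'v) \<Rightarrow> 'g \<Rightarrow> ('g \<Rightarrow> 'v) \<Rightarrow> ('g \<Rightarrow> 'v)" where
  "ind_rep G H V \<sigma> g =
     (\<lambda>f\<in>carrier (ind_space G H V \<sigma>). \<lambda>x. if x \<in> carrier G then f (x \<otimes>\<^bsub>G\<^esub> g) else 0)"

section \<open>Thompson's group\<close>

definition piecewise_linear :: "(real \<Rightarrow> real) \<Rightarrow> bool" where
  "piecewise_linear f \<longleftrightarrow>
     (\<exists>S. finite S \<and>
        (\<forall>u v. 0 \<le> u \<and> u < v \<and> v \<le> 1 \<and> S \<inter> {u<..<v} = {} \<longrightarrow>
           (\<exists>m c. \<forall>x\<in>{u..v}. f x = m * x + c)))"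

text \<open>The library's \<^const>\<open>dyadics\<close> are the nonnegative dyadic rationals. Differentiability at
  the end points is one-sided.\<close>

definition thompson_F :: "(real \<Rightarrow> real) monoid" where
  "thompson_F = BijGroup {0..1}\<lparr>carrier :=
     {f \<in> Bij {0..1}.
        homeomorphism {0..1} {0..1} f (inv_into {0..1} f) \<and>
        strict_mono_on {0..1} f \<and>
        piecewise_linear f \<and>
        f ` (dyadics \<inter> {0..1}) = dyadics \<inter> {0..1} \<and>
        finite {t \<in> {0..1}. \<not> f differentiable (at t within {0..1})} \<and>
        {t \<in> {0..1}. \<not> f differentiable (at t within {0..1})} \<subseteq> dyadics \<and>
        (\<forall>t\<in>{0..1}. \<forall>m. (f has_real_derivative m) (at t within {0..1}) \<longrightarrow>
           (\<exists>k::int. m = 2 powi k))}\<rparr>"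

definition stab_F :: "real \<Rightarrow> (real \<Rightarrow> real) set" where
  "stab_F p = {\<gamma> \<in> carrier thompson_F. \<gamma> p = p}"

definition stab_group :: "real \<Rightarrow> (real \<Rightarrow> real) monoid" where
  "stab_group p = thompson_F\<lparr>carrier := stab_F p\<rparr>"

definition conj_rep ::
    "('g, 'x) monoid_scheme \<Rightarrow> 'g \<Rightarrow> ('g \<Rightarrow> 'v \<Rightarrow> 'v) \<Rightarrow> 'g \<Rightarrow> 'v \<Rightarrow> 'v" where
  "conj_rep G \<gamma> \<sigma> x = \<sigma> (\<gamma> \<otimes>\<^bsub>G\<^esub> x \<otimes>\<^bsub>G\<^esub> inv\<^bsub>G\<^esub> \<gamma>)"

end

theory Submission
  imports Defs
begin

text \<open>
  Let \<open>T\<close> be a bounded \<open>H\<close>-intertwiner from a finite-dimensional unitary representation \<open>V\<close> of \<open>H\<close>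
  into a representation induced from \<open>K\<close>, and \<open>E\<close> an orthonormal basis of \<open>V\<close>. Unitarity of \<open>H\<close> gives
  \<open>\<parallel>T v x\<parallel> \<le> \<parallel>v\<parallel> \<Sum>e\<in>E. \<parallel>T e (x h)\<parallel>\<close> for every \<open>h \<in> H\<close>, and the right-hand side comes arbitrarily close
  to \<open>0\<close> when the cosets \<open>K x h\<close> are infinitely many; so \<open>T v\<close> lives on the finite \<open>H\<close>-orbits of \<open>K \ G\<close>.
  For point stabilizers in \<open>F\<close> the only possible finite orbit is the coset of the elements moving \<open>p\<close>
  to \<open>q\<close>, because bump-like elements of \<open>F\<close> fix one point and move another one arbitrarily often.
  Applied to the orthogonal projection onto an invariant subspace, restricted to the functions
  supported on the trivial coset, this yields irreducibility; applied to a unitary equivalence of the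
  induced representations it yields the conjugating element and the intertwiner.
\<close>

section \<open>Hilbert spaces\<close>

text \<open>The infinite-orbit condition is Mackey's criterion: \<open>H x H\<close> contains
  infinitely many cosets of \<open>H\<close> for every \<open>x\<close> outside \<open>H\<close>.
  Finite dimension of the inducing representation enters in two ways. In the estimate it makes the
  sum over \<open>E\<close> finite, so that all but finitely many cosets of an infinite orbit make
  all functions \<open>T e\<close> small at once; infinitely many square-summable functions could
  take turns in being large. It also makes every linear subspace closed, so that irreducibility,
  which speaks of closed subspaces, applies to the subspaces of the inducing space that are
  constructed algebraically. That \<open>p\<close> and \<open>q\<close> are interior matters because
  elements of F fix \<open>0\<close> and \<open>1\<close>: the preimage of an interior point is
  interior, and a small interval around it that avoids the fixed point carries a nontrivial element
  of F. The points themselves may be nondyadic; only that interval has dyadic ends.\<close>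

lemma unitary_mapD:
  assumes "unitary_map V W U"
  shows "bij_betw U (carrier V) (carrier W)"
    and "x \<in> carrier V \<Longrightarrow> U x \<in> carrier W"
    and "\<lbrakk>x \<in> carrier V; y \<in> carrier V\<rbrakk> \<Longrightarrow> U (x + y) = U x + U y"
    and "x \<in> carrier V \<Longrightarrow> U (scaleC c x) = scaleC c (U x)"
    and "\<lbrakk>x \<in> carrier V; y \<in> carrier V\<rbrakk> \<Longrightarrow> cinner W (U x) (U y) = cinner V x y"
    and "x \<in> carrier V \<Longrightarrow> hnorm W (U x) = hnorm V x"
  using assms by (auto simp: unitary_map_def hnorm_def dest: bij_betwE)

context pre_hilbert_space
begin

lemma cinner_diff_left:
  "\<lbrakk>x \<in> carrier V; y \<in> carrier V; z \<in> carrier V\<rbrakk>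
    \<Longrightarrow> cinner V (x - y) z = cinner V x z - cinner V y z"
  using cinner_add_left[of "x - y" y z] diff_carrier[of x y] by simp

lemma cinner_diff_right:
  "\<lbrakk>x \<in> carrier V; y \<in> carrier V; z \<in> carrier V\<rbrakk>
    \<Longrightarrow> cinner V x (y - z) = cinner V x y - cinner V x z"
  using cinner_add_right[of x "y - z" z] diff_carrier[of y z] by simp

lemma cinner_zero_right: "x \<in> carrier V \<Longrightarrow> cinner V x 0 = 0"
  using cinner_commute[of x 0] cinner_zero_left[of x] zero_carrier by simp

lemma hnorm_zero: "hnorm V 0 = 0"
  using hnorm_eq_0_iff zero_carrier by blast

lemma cinner_self: "x \<in> carrier V \<Longrightarrow> cinner V x x = of_real ((hnorm V x)\<^sup>2)"
  using cinner_commute[of x x] cinner_nonneg[of x] by (simp add: complex_eq_iff hnorm_def)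

lemma eq_zero_if_cinner_self: "\<lbrakk>x \<in> carrier V; cinner V x x = 0\<rbrakk> \<Longrightarrow> x = 0"
  using cinner_self hnorm_eq_0_iff by fastforce

text \<open>Multiplying \<open>x\<close> by a scalar of modulus 1 makes the inner product real and
  nonnegative, and for such a value \<open>Re_cinner_bound\<close> is the full estimate.\<close>

lemma cmod_cinner_le:
  assumes x: "x \<in> carrier V" and y: "y \<in> carrier V"
  shows "cmod (cinner V x y) \<le> hnorm V x * hnorm V y"
proof (cases "cinner V x y = 0")
  case True
  then show ?thesis by (simp add: hnorm_nonneg x y)
next
  case False
  define c where "c = cnj (cinner V x y) / of_real (cmod (cinner V x y))"
  have c1: "cmod c = 1" using False by (simp add: c_def norm_divide)
  have "c * cinner V x y = of_real (cmod (cinner V x y))"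
    using False complex_norm_square[of "cinner V x y"]
    by (simp add: c_def field_simps power2_eq_square)
  then have "cmod (cinner V x y) = Re (cinner V (scaleC c x) y)"
    by (simp add: cinner_scaleC_left x y)
  also have "\<dots> \<le> hnorm V (scaleC c x) * hnorm V y"
    by (intro Re_cinner_bound scaleC_carrier x y)
  finally show ?thesis by (simp add: hnorm_scaleC x c1)
qed

lemma hnorm_diff_commute:
  "\<lbrakk>x \<in> carrier V; y \<in> carrier V\<rbrakk> \<Longrightarrow> hnorm V (x - y) = hnorm V (y - x)"
  using commute[of x y] by (simp add: hdist_def)

lemma hnorm_diff_triangle:
  "\<lbrakk>x \<in> carrier V; y \<in> carrier V; z \<in> carrier V\<rbrakk>
    \<Longrightarrow> hnorm V (x - z) \<le> hnorm V (x - y) + hnorm V (y - z)"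
  using triangle[of x y z] by (simp add: hdist_def)

lemma limitin_hnorm_diff:
  assumes "limitin mtopology f l sequentially" and "\<And>n. f n \<in> carrier V"
  shows "(\<lambda>n. hnorm V (f n - l)) \<longlonglongrightarrow> 0"
  using assms
  by (auto simp: limit_metric_sequentially LIMSEQ_iff hdist_def hnorm_nonneg diff_carrier)

lemma sum_carrier: "(\<And>i. i \<in> A \<Longrightarrow> f i \<in> carrier V) \<Longrightarrow> sum f A \<in> carrier V"
  by (rule cvec.subspace_sum[OF subspace_carrier])

lemma cinner_sum_left:
  assumes "\<And>i. i \<in> A \<Longrightarrow> f i \<in> carrier V" and "y \<in> carrier V"
  shows "cinner V (sum f A) y = (\<Sum>i\<in>A. cinner V (f i) y)"
  using assms
  by (induction A rule: infinite_finite_induct)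
     (simp_all add: cinner_zero_left cinner_add_left sum_carrier)

lemma hnorm_sum:
  assumes "\<And>i. i \<in> A \<Longrightarrow> f i \<in> carrier V"
  shows "hnorm V (sum f A) \<le> (\<Sum>i\<in>A. hnorm V (f i))"
  using assms
proof (induction A rule: infinite_finite_induct)
  case (insert a A)
  then show ?case
    using hnorm_triangle[of "f a" "sum f A"] sum_carrier[of A f] by force
qed (simp_all add: hnorm_zero)

section \<open>Orthonormal families and subspaces in finite dimension\<close>

definition orthonormal :: "'v set \<Rightarrow> bool" where
  "orthonormal E \<longleftrightarrow> E \<subseteq> carrier V \<and>
     (\<forall>e\<in>E. \<forall>e'\<in>E. cinner V e e' = (if e = e' then 1 else 0))"

lemma span_subset_carrier: "B \<subseteq> carrier V \<Longrightarrow> cvec.span B \<subseteq> carrier V"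
  by (rule cvec.span_minimal[OF _ subspace_carrier])

lemma orthonormal_residual:
  assumes E: "orthonormal E" "finite E" and x: "x \<in> carrier V" and e: "e \<in> E"
  shows "cinner V (x - (\<Sum>e\<in>E. scaleC (cinner V x e) e)) e = 0"
proof -
  have sub: "E \<subseteq> carrier V" using E by (simp add: orthonormal_def)
  have "cinner V (\<Sum>e\<in>E. scaleC (cinner V x e) e) e
      = (\<Sum>e'\<in>E. if e' = e then cinner V x e else 0)"
    using E e sub x
    by (subst cinner_sum_left)
       (auto simp: scaleC_carrier subset_iff cinner_scaleC_left orthonormal_def intro!: sum.cong
          simp del: sum.delta sum.delta')
  also have "\<dots> = cinner V x e" using E e by simp
  finally show ?thesis
    using sub e x by (subst cinner_diff_left) (auto intro!: sum_carrier scaleC_carrier)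
qed

lemma cinner_eq_0_span:
  assumes "x \<in> carrier V" and "B \<subseteq> carrier V" and "\<And>b. b \<in> B \<Longrightarrow> cinner V x b = 0"
    and "y \<in> cvec.span B"
  shows "cinner V x y = 0"
proof -
  have "cvec.subspace {y \<in> carrier V. cinner V x y = 0}"
    using assms(1)
    by (auto simp: cvec.subspace_def zero_carrier add_carrier scaleC_carrier cinner_zero_right
        cinner_add_right cinner_scaleC_right)
  then have "cvec.span B \<subseteq> {y \<in> carrier V. cinner V x y = 0}"
    using assms by (intro cvec.span_minimal) auto
  then show ?thesis using assms(4) by auto
qed

text \<open>Gram-Schmidt: a vector with residual \<open>r = 0\<close> is dropped, otherwise the
  normalized residual joins \<open>E\<close>. The span is the same as with \<open>b\<close> because
  \<open>w\<close> lies in the span of \<open>E\<close>.\<close>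

lemma orthonormal_span_exists:
  assumes "finite B" and "B \<subseteq> carrier V"
  shows "\<exists>E. finite E \<and> orthonormal E \<and> cvec.span E = cvec.span B"
  using assms
proof (induction B)
  case empty
  have "orthonormal {}" by (simp add: orthonormal_def)
  then show ?case by blast
next
  case (insert b B)
  then obtain E where E: "finite E" "orthonormal E" "cvec.span E = cvec.span B" by auto
  have sub: "E \<subseteq> carrier V" using E by (simp add: orthonormal_def)
  define w where "w = (\<Sum>e\<in>E. scaleC (cinner V b e) e)"
  define r where "r = b - w"
  have w: "w \<in> cvec.span E"
    unfolding w_def by (intro cvec.span_sum cvec.span_scale cvec.span_base)
  have b: "b \<in> carrier V" using insert by auto
  then have r: "r \<in> carrier V"
    using w span_subset_carrier[OF sub] by (auto simp: r_def diff_carrier)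
  have rE: "cinner V r e = 0" if "e \<in> E" for e
    using orthonormal_residual[OF E(2,1) b that] by (simp add: r_def w_def)
  have spB: "cvec.span (insert b B) = cvec.span (insert b E)"
    by (simp add: cvec.span_insert E)
  show ?case
  proof (cases "r = 0")
    case True
    then have "b \<in> cvec.span E" using w by (simp add: r_def)
    then show ?thesis using E spB by (auto simp: cvec.span_redundant)
  next
    case False
    define n where "n = complex_of_real (hnorm V r)"
    have n0: "n \<noteq> 0" using False r by (simp add: n_def hnorm_eq_0_iff)
    define e0 where "e0 = scaleC (inverse n) r"
    have e0: "e0 \<in> carrier V" by (simp add: e0_def r scaleC_carrier)
    have e00: "cinner V e0 e0 = 1"
      using n0 r cinner_self[OF e0]
      by (simp add: e0_def hnorm_scaleC n_def norm_inverse norm_divide hnorm_nonneg)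
    have e0E: "cinner V e0 e = 0" "cinner V e e0 = 0" if "e \<in> E" for e
    proof -
      show "cinner V e0 e = 0"
        using sub that rE r by (auto simp: e0_def cinner_scaleC_left)
      then show "cinner V e e0 = 0"
        using cinner_commute[of e e0] sub that e0 by auto
    qed
    have "orthonormal (insert e0 E)"
      using E(2) e0 e00 e0E by (auto simp: orthonormal_def)
    moreover have "cvec.span (insert e0 E) = cvec.span (insert b E)"
      unfolding cvec.span_eq
    proof (intro conjI subsetI)
      have bs: "b \<in> cvec.span (insert b E)" by (simp add: cvec.span_base)
      have ws: "w \<in> cvec.span (insert z E)" for z
        using w cvec.span_mono[of E "insert z E"] by auto
      show "x \<in> cvec.span (insert b E)" if "x \<in> insert e0 E" for x
      proof (cases "x = e0")
        case True
        show ?thesis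
          unfolding True e0_def r_def by (intro cvec.span_scale cvec.span_diff bs ws)
      qed (use that in \<open>auto intro: cvec.span_base\<close>)
      have "b = scaleC n e0 + w"
        using n0 by (simp add: e0_def r_def scaleC_scaleC scaleC_one)
      moreover have "scaleC n e0 + w \<in> cvec.span (insert e0 E)"
        by (intro cvec.span_add cvec.span_scale ws) (simp add: cvec.span_base)
      ultimately show "x \<in> cvec.span (insert e0 E)" if "x \<in> insert b E" for x
        using that by (auto intro: cvec.span_base)
    qed
    ultimately show ?thesis using E(1) spB by (metis finite_insert)
  qed
qed

text \<open>The residual lies in the span and is orthogonal to it, hence to itself.\<close>

lemma orthonormal_expansion:
  assumes E: "orthonormal E" "finite E" and x: "x \<in> cvec.span E"
  shows "x = (\<Sum>e\<in>E. scaleC (cinner V x e) e)"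
proof -
  have sub: "E \<subseteq> carrier V" using E by (simp add: orthonormal_def)
  have xc: "x \<in> carrier V" using x span_subset_carrier[OF sub] by auto
  define r where "r = x - (\<Sum>e\<in>E. scaleC (cinner V x e) e)"
  have rs: "r \<in> cvec.span E"
    unfolding r_def by (intro cvec.span_diff x cvec.span_sum cvec.span_scale cvec.span_base)
  then have rc: "r \<in> carrier V" using span_subset_carrier[OF sub] by auto
  have "cinner V r r = 0"
    by (rule cinner_eq_0_span[OF rc sub _ rs])
       (simp only: r_def orthonormal_residual[OF E xc])
  then have "r = 0" using rc eq_zero_if_cinner_self by blast
  then show ?thesis by (simp add: r_def)
qed

lemma finite_dimensional_orthonormal_basis:
  assumes "finite_dimensional V"
  obtains E where "finite E" "orthonormal E" "cvec.span E = carrier V"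
proof -
  obtain B where "finite B" "cvec.span B = carrier V"
    using assms by (auto simp: finite_dimensional_def)
  then show thesis
    using orthonormal_span_exists[of B] that cvec.span_superset[of B] by auto
qed

text \<open>The residual \<open>r\<close> of a point \<open>x\<close> outside \<open>S\<close> is
  the shortest vector from \<open>S\<close> to \<open>x\<close>, so the open ball of radius
  \<open>hnorm V r\<close> around \<open>x\<close> misses \<open>S\<close>.\<close>

lemma finite_dimensional_closed_subspace:
  assumes fd: "finite_dimensional V" and S: "cvec.subspace S" "S \<subseteq> carrier V"
  shows "closed_subspace V S"
proof -
  obtain C where C: "finite C" "cvec.span C = carrier V"
    using fd by (auto simp: finite_dimensional_def)
  obtain B where B: "B \<subseteq> S" "cvec.independent B" "S \<subseteq> cvec.span B"
    using cvec.basis_exists[of S] by metis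
  have "finite B"
    using cvec.independent_span_bound[OF C(1) B(2)] B(1) S(2) C(2) by auto
  moreover have "cvec.span B = S"
    using B S(1) cvec.span_minimal by blast
  ultimately obtain E where E: "finite E" "orthonormal E" "cvec.span E = S"
    using orthonormal_span_exists[of B] B S by auto
  have sub: "E \<subseteq> carrier V" using E by (simp add: orthonormal_def)
  show ?thesis
    unfolding closed_subspace_def closedin_metric
  proof (intro conjI allI impI S)
    fix x assume x: "x \<in> carrier V - S"
    define r where "r = x - (\<Sum>e\<in>E. scaleC (cinner V x e) e)"
    have w: "(\<Sum>e\<in>E. scaleC (cinner V x e) e) \<in> S"
      unfolding E(3)[symmetric] by (intro cvec.span_sum cvec.span_scale cvec.span_base)
    have rc: "r \<in> carrier V"
      using w S(2) x by (auto simp: r_def diff_carrier)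
    have r0: "r \<noteq> 0" using w x by (auto simp: r_def)
    then have rpos: "0 < hnorm V r"
      using rc hnorm_nonneg hnorm_eq_0_iff by (metis less_eq_real_def)
    have xc: "x \<in> carrier V" using x by simp
    have rS: "cinner V r y = 0" if "y \<in> S" for y
      by (rule cinner_eq_0_span[OF rc sub])
         (simp_all only: r_def orthonormal_residual[OF E(2,1) xc] E(3) that)
    \<comment> \<open>\<open>x - y\<close> and \<open>r\<close> differ by a vector of
      \<open>S\<close>, so they have the same inner product with \<open>r\<close>; Cauchy-Schwarz
      does the rest.\<close>
    have "hnorm V r \<le> hdist V x y" if y: "y \<in> S" for y
    proof -
      have yc: "y \<in> carrier V" using y S by auto
      define z where "z = (\<Sum>e\<in>E. scaleC (cinner V x e) e) - y"
      have z: "z \<in> S" using w y S by (auto simp: z_def cvec.subspace_diff)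
      then have zc: "z \<in> carrier V" using S by auto
      have "x - y = r + z" by (simp add: r_def z_def)
      then have "cinner V (x - y) r = of_real ((hnorm V r)\<^sup>2)"
        using rc zc rS[OF z] cinner_commute[of z r] by (simp add: cinner_add_left cinner_self)
      then have "(hnorm V r)\<^sup>2 \<le> hnorm V (x - y) * hnorm V r"
        using Re_cinner_bound[of "x - y" r] x yc rc by (simp add: diff_carrier)
      then show ?thesis
        using rpos x yc by (simp add: power2_eq_square hdist_def)
    qed
    then show "\<exists>r>0. disjnt S (mball x r)"
      using rpos by (intro exI[of _ "hnorm V r"]) (force simp: disjnt_iff)
  qed
qed

end

text \<open>A sequence in \<open>W\<close> whose squared distances to \<open>x\<close> tend to the
  infimum is Cauchy by the parallelogram law. Orthogonality is proved along the sequence up to an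
  error that tends to \<open>0\<close>, and then passes to the limit.\<close>

lemma (in hilbert_space) orthogonal_projection_exists:
  assumes W: "closed_subspace V W" and x: "x \<in> carrier V"
  shows "\<exists>w\<in>W. \<forall>y\<in>W. cinner V (x - w) y = 0"
proof -
  have sW: "cvec.subspace W" and cW: "closedin mtopology W"
    using W by (auto simp: closed_subspace_def)
  have WV: "y \<in> carrier V" if "y \<in> W" for y
    using closedin_subset[OF cW] that by auto
  define D where "D = (\<lambda>w. (hnorm V (x - w))\<^sup>2) ` W"
  have D0: "D \<noteq> {}" using cvec.subspace_0[OF sW] by (auto simp: D_def)
  have bdd: "bdd_below D" by (auto simp: D_def intro!: bdd_belowI[of _ 0])
  have dle: "Inf D \<le> (hnorm V (x - w))\<^sup>2" if "w \<in> W" for w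
    using that bdd by (auto simp: D_def intro: cInf_lower)
  have "\<exists>w\<in>W. (hnorm V (x - w))\<^sup>2 < Inf D + 1 / real (Suc n)" for n
    using cInf_lessD[OF D0, of "Inf D + 1 / real (Suc n)"] by (auto simp: D_def)
  then obtain w where w: "\<And>n. w n \<in> W"
    and wd: "\<And>n. (hnorm V (x - w n))\<^sup>2 < Inf D + 1 / real (Suc n)" by metis
  have sq: "(hnorm V y)\<^sup>2 = Re (cinner V y y)" if "y \<in> carrier V" for y
    using that by (simp add: hnorm_def cinner_nonneg)
  \<comment> \<open>The midpoint \<open>h\<close> belongs to \<open>W\<close>, which bounds
    \<open>a + b\<close> from below by the infimum; the parallelogram law then leaves only the two
    errors for \<open>b - a\<close>.\<close>
  have close: "(hnorm V (w n - w m))\<^sup>2 \<le> 2 / real (Suc n) + 2 / real (Suc m)" for n m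
  proof -
    define a where "a = x - w n"
    define b where "b = x - w m"
    have ab: "a \<in> carrier V" "b \<in> carrier V"
      using w x WV by (auto simp: a_def b_def diff_carrier)
    define h where "h = scaleC (1/2) (w n + w m)"
    have h: "h \<in> W" by (simp add: h_def w sW cvec.subspace_scale cvec.subspace_add)
    have "x = scaleC (1/2) x + scaleC (1/2) x"
      by (simp flip: scaleC_add_left add: scaleC_one)
    then have "x - h = scaleC (1/2) (a + b)"
      unfolding h_def a_def b_def
      by (simp add: cvec.scale_right_diff_distrib scaleC_add_right algebra_simps)
    then have "hnorm V (a + b) = 2 * hnorm V (x - h)"
      using ab by (simp add: hnorm_scaleC add_carrier)
    then have "4 * Inf D \<le> (hnorm V (a + b))\<^sup>2"
      using dle[OF h] by (simp only: power_mult_distrib) simp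
    moreover have "(hnorm V (a + b))\<^sup>2 + (hnorm V (b - a))\<^sup>2
        = 2 * (hnorm V a)\<^sup>2 + 2 * (hnorm V b)\<^sup>2"
      using ab by (simp add: sq add_carrier diff_carrier cinner_add_left cinner_add_right
          cinner_diff_left cinner_diff_right)
    moreover have "b - a = w n - w m" by (simp add: a_def b_def)
    ultimately show ?thesis
      using wd[of n] wd[of m] by (simp add: a_def b_def)
  qed
  have "MCauchy w"
    unfolding MCauchy_def
  proof (intro conjI allI impI)
    show "range w \<subseteq> carrier V" using w WV by auto
    fix e :: real assume e: "0 < e"
    \<comment> \<open>This bound puts each of the two error terms of \<open>close\<close> below half
      of \<open>e\<^sup>2\<close>.\<close>
    then obtain N where N: "4 / e\<^sup>2 < real N" using reals_Archimedean2 by blast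
    show "\<exists>N. \<forall>n n'. N \<le> n \<longrightarrow> N \<le> n' \<longrightarrow> hdist V (w n) (w n') < e"
    proof (intro exI allI impI)
      fix n m assume nm: "N \<le> n" "N \<le> m"
      have half: "2 / real (Suc k) < e\<^sup>2 / 2" if "N \<le> k" for k
      proof -
        have "4 / e\<^sup>2 < real (Suc k)" using N that by linarith
        then show ?thesis using e by (simp add: field_simps)
      qed
      have "(hnorm V (w n - w m))\<^sup>2 < e\<^sup>2"
        using close[of n m] half[OF nm(1)] half[OF nm(2)] by linarith
      then have "hnorm V (w n - w m) < e" using e by (simp add: power_less_imp_less_base)
      then show "hdist V (w n) (w m) < e" using w WV by (simp add: hdist_def)
    qed
  qed
  then obtain l where l: "limitin mtopology w l sequentially"
    using complete mcomplete_def by blast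
  have lW: "l \<in> W"
    using l cW w unfolding metric_closedin_iff_sequentially_closed by blast
  then have lc: "l \<in> carrier V" using WV by auto
  have "cinner V (x - l) y = 0" if y: "y \<in> W" for y
  proof -
    have yc: "y \<in> carrier V" using y WV by auto
    \<comment> \<open>Moving an almost optimal \<open>w n\<close> along \<open>y\<close> cannot gain more than \<open>1 / Suc n\<close>.\<close>
    have almost: "(cmod (cinner V (x - w n) y))\<^sup>2 \<le> (hnorm V y)\<^sup>2 / real (Suc n)" for n
    proof (cases "y = 0")
      case True
      then show ?thesis
        using x w WV by (simp add: cinner_zero_right diff_carrier hnorm_zero)
    next
      case False
      define a where "a = x - w n"
      have a: "a \<in> carrier V" using x w WV by (simp add: a_def diff_carrier)
      define N where "N = (hnorm V y)\<^sup>2"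
      have N: "0 < N" using False yc by (simp add: N_def hnorm_eq_0_iff)
      define c where "c = cinner V a y"
      \<comment> \<open>With this \<open>t\<close>, \<open>scaleC t y\<close> is the projection of
        \<open>a\<close> onto the line of \<open>y\<close>; subtracting it lowers the squared norm
        by \<open>(cmod c)\<^sup>2 / N\<close>, the largest possible gain.\<close>
      define t where "t = c / of_real N"
      have ty: "scaleC t y \<in> carrier V" by (simp add: yc scaleC_carrier)
      have "Inf D \<le> (hnorm V (x - (w n + scaleC t y)))\<^sup>2"
        by (intro dle cvec.subspace_add[OF sW] w cvec.subspace_scale[OF sW] y)
      also have "x - (w n + scaleC t y) = a - scaleC t y" by (simp add: a_def)
      also have "cinner V (a - scaleC t y) (a - scaleC t y)
          = cinner V a a - of_real ((cmod c)\<^sup>2 / N)"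
        using N cinner_commute[OF yc a] complex_norm_square[of c]
        by (simp add: cinner_diff_left cinner_diff_right a ty cinner_scaleC_left cinner_scaleC_right
            yc diff_carrier cinner_self[OF yc] flip: N_def c_def)
           (simp add: t_def field_simps)
      then have "(hnorm V (a - scaleC t y))\<^sup>2 = (hnorm V a)\<^sup>2 - (cmod c)\<^sup>2 / N"
        using a ty by (simp add: sq diff_carrier)
      finally have "(cmod c)\<^sup>2 / N \<le> 1 / real (Suc n)"
        using wd[of n] by (simp add: a_def)
      then show ?thesis using N by (simp add: field_simps c_def a_def N_def)
    qed
    have "(\<lambda>n. sqrt ((hnorm V y)\<^sup>2 * inverse (real (Suc n))) + hnorm V (w n - l) * hnorm V y)
        \<longlonglongrightarrow> sqrt ((hnorm V y)\<^sup>2 * 0) + 0 * hnorm V y"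
      by (intro tendsto_intros LIMSEQ_inverse_real_of_nat limitin_hnorm_diff[OF l]) (use w WV in auto)
    moreover have "cmod (cinner V (x - l) y)
        \<le> sqrt ((hnorm V y)\<^sup>2 * inverse (real (Suc n))) + hnorm V (w n - l) * hnorm V y" for n
    proof -
      have "cinner V (x - l) y = cinner V (x - w n) y + cinner V (w n - l) y"
        using x lc w WV yc by (subst cinner_add_left[symmetric]) (auto simp: diff_carrier)
      also have "cmod \<dots> \<le> cmod (cinner V (x - w n) y) + cmod (cinner V (w n - l) y)"
        by (rule norm_triangle_ineq)
      also have "cmod (cinner V (x - w n) y) \<le> sqrt ((hnorm V y)\<^sup>2 * inverse (real (Suc n)))"
        using almost[of n] by (intro real_le_rsqrt) (simp add: divide_inverse)
      also have "cmod (cinner V (w n - l) y) \<le> hnorm V (w n - l) * hnorm V y"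
        by (intro cmod_cinner_le diff_carrier w[THEN WV] lc yc)
      finally show ?thesis by simp
    qed
    ultimately have "cmod (cinner V (x - l) y) \<le> sqrt ((hnorm V y)\<^sup>2 * 0) + 0 * hnorm V y"
      by (intro LIMSEQ_le_const) auto
    then show ?thesis by simp
  qed
  then show ?thesis using lW by blast
qed

section \<open>Induced representations\<close>

text \<open>Each such point contributes at least \<open>e\<close> to the sum. This converts square
  summability into finiteness of a set of cosets.\<close>

lemma finite_superlevel_if_summable_on:
  fixes f :: "'a \<Rightarrow> real"
  assumes sm: "f summable_on A" and nn: "\<And>x. x \<in> A \<Longrightarrow> 0 \<le> f x" and e: "0 < e"
  shows "finite {x \<in> A. e \<le> f x}"
proof (rule ccontr)
  assume inf: "infinite {x \<in> A. e \<le> f x}"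
  obtain n where n: "infsum f A / e < real n" using reals_Archimedean2 by blast
  obtain F where F: "finite F" "card F = n" "F \<subseteq> {x \<in> A. e \<le> f x}"
    using infinite_arbitrarily_large[OF inf] by blast
  have "real n * e = (\<Sum>x\<in>F. e)" using F by simp
  also have "\<dots> \<le> sum f F" using F by (intro sum_mono) auto
  also have "\<dots> \<le> infsum f A" using F nn by (intro finite_sum_le_infsum sm) auto
  finally show False using n e by (simp add: field_simps)
qed

locale induced_rep = group G + V: hilbert_space V
  for G :: "('g, 'x) monoid_scheme" (structure) and V :: "('v::complex_vector, 'y) hspace_scheme" +
  fixes H :: "'g set" and \<sigma> :: "'g \<Rightarrow> 'v \<Rightarrow> 'v"
  assumes sub: "subgroup H G"
    and sigma_hom: "\<sigma> \<in> hom (G\<lparr>carrier := H\<rparr>) (unitary_group V)"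
begin

lemma
  shows H_carrier: "h \<in> H \<Longrightarrow> h \<in> carrier G"
    and H_one: "\<one> \<in> H"
    and H_mult: "h \<in> H \<Longrightarrow> k \<in> H \<Longrightarrow> h \<otimes> k \<in> H"
    and H_inv: "h \<in> H \<Longrightarrow> inv h \<in> H"
  using sub
  by (auto intro: subgroup.mem_carrier subgroup.one_closed subgroup.m_closed subgroup.m_inv_closed)

lemma mult_mem_iff: "\<lbrakk>h \<in> H; x \<in> carrier G\<rbrakk> \<Longrightarrow> h \<otimes> x \<in> H \<longleftrightarrow> x \<in> H"
  by (metis H_carrier H_inv H_mult inv_closed inv_solve_left m_closed)

lemma sigma_unitary: "h \<in> H \<Longrightarrow> unitary_map V V (\<sigma> h)"
  using sigma_hom by (auto simp: hom_def unitary_group_def)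

lemmas sigma_carrier = unitary_mapD(2)[OF sigma_unitary]
  and sigma_add = unitary_mapD(3)[OF sigma_unitary]
  and sigma_scaleC = unitary_mapD(4)[OF sigma_unitary]
  and sigma_cinner = unitary_mapD(5)[OF sigma_unitary]
  and sigma_hnorm = unitary_mapD(6)[OF sigma_unitary]

lemma sigma_mult:
  assumes "h \<in> H" and "k \<in> H" and "v \<in> carrier V"
  shows "\<sigma> (h \<otimes> k) v = \<sigma> h (\<sigma> k v)"
proof -
  have "\<sigma> h \<in> Bij (carrier V)" "\<sigma> k \<in> Bij (carrier V)"
    using sigma_hom assms by (auto simp: hom_def unitary_group_def)
  then show ?thesis
    using sigma_hom assms
    by (auto simp: hom_def unitary_group_def BijGroup_def compose_def)
qed

text \<open>A homomorphism is only known to be multiplicative here, so \<sigma> sends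
  \<open>\<one>\<close> to an idempotent; being injective as well, it is the identity.\<close>

lemma sigma_one: "v \<in> carrier V \<Longrightarrow> \<sigma> \<one> v = v"
  using sigma_mult[OF H_one H_one, of v] unitary_mapD(1)[OF sigma_unitary[OF H_one]]
    sigma_carrier[OF H_one, of v]
  by (auto simp: bij_betw_def inj_on_def)

lemma sigma_diff:
  assumes "h \<in> H" and "v \<in> carrier V" and "w \<in> carrier V"
  shows "\<sigma> h (v - w) = \<sigma> h v - \<sigma> h w"
  using sigma_add[OF assms(1), of "v - w" w] assms by (simp add: V.diff_carrier)

lemma sigma_zero: "h \<in> H \<Longrightarrow> \<sigma> h 0 = 0"
  using sigma_diff[of h 0 0] V.zero_carrier by simp

lemma coset_rep_mem: "C \<in> rcosets H \<Longrightarrow> coset_rep C \<in> C"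
  unfolding coset_rep_def by (rule someI_ex) (use rcos_self[OF _ sub] in \<open>auto simp: RCOSETS_def\<close>)

lemma coset_rep_carrier: "C \<in> rcosets H \<Longrightarrow> coset_rep C \<in> carrier G"
  using coset_rep_mem subgroup.rcosets_carrier[OF sub is_group] by blast

lemma coset_eq:
  assumes "C \<in> rcosets H" and "x \<in> C" shows "H #> x = C"
  using assms repr_independence[OF _ _ sub] by (force simp: RCOSETS_def)

lemma rcosetI: "x \<in> carrier G \<Longrightarrow> H #> x \<in> rcosets H"
  by (rule rcosetsI[OF subgroup.subset[OF sub]])

text \<open>The conditions of \<open>ind_space\<close> other than summability. They are split off
  because the limit in the completeness proof is known to be equivariant before it is known to be
  square-summable.\<close>

definition equivariant :: "('g \<Rightarrow> 'v) \<Rightarrow> bool" where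
  "equivariant f \<longleftrightarrow> (\<forall>x. x \<notin> carrier G \<longrightarrow> f x = 0) \<and> (\<forall>x\<in>carrier G. f x \<in> carrier V) \<and>
     (\<forall>h\<in>H. \<forall>x\<in>carrier G. f (h \<otimes> x) = \<sigma> h (f x))"

lemma equivariantD:
  assumes "equivariant f"
  shows "x \<notin> carrier G \<Longrightarrow> f x = 0" and "x \<in> carrier G \<Longrightarrow> f x \<in> carrier V"
    and "\<lbrakk>h \<in> H; x \<in> carrier G\<rbrakk> \<Longrightarrow> f (h \<otimes> x) = \<sigma> h (f x)"
  using assms by (auto simp: equivariant_def)

lemma equivariant_zero: "equivariant 0"
  by (simp add: equivariant_def V.zero_carrier sigma_zero)

lemma equivariant_add: "\<lbrakk>equivariant f; equivariant k\<rbrakk> \<Longrightarrow> equivariant (f + k)"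
  by (simp add: equivariant_def V.add_carrier sigma_add)

lemma equivariant_scaleC: "equivariant f \<Longrightarrow> equivariant (scaleC c f)"
  by (simp add: equivariant_def scaleC_fun_def V.scaleC_carrier sigma_scaleC)

lemma equivariant_cinner:
  assumes "equivariant f" and "equivariant k" and "x \<in> carrier G" and "y \<in> H #> x"
  shows "cinner V (f y) (k y) = cinner V (f x) (k x)"
  using assms by (auto simp: r_coset_def equivariantD sigma_cinner)

lemma equivariant_hnorm:
  "\<lbrakk>equivariant f; x \<in> carrier G; y \<in> H #> x\<rbrakk> \<Longrightarrow> hnorm V (f y) = hnorm V (f x)"
  by (simp add: hnorm_def equivariant_cinner)

lemma coset_rep_in_rcoset: "x \<in> carrier G \<Longrightarrow> coset_rep (H #> x) \<in> H #> x"
  by (simp add: coset_rep_mem rcosetI)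

abbreviation I where "I \<equiv> ind_space G H V \<sigma>"

abbreviation \<pi> where "\<pi> \<equiv> ind_rep G H V \<sigma>"

section \<open>The Hilbert space of square-summable equivariant functions\<close>

lemma mem_I_iff: "f \<in> carrier I \<longleftrightarrow> equivariant f \<and>
    (\<lambda>C. (hnorm V (f (coset_rep C)))\<^sup>2) summable_on (rcosets H)"
  by (auto simp: ind_space_def equivariant_def)

lemma I_equivariant: "f \<in> carrier I \<Longrightarrow> equivariant f"
  by (simp add: mem_I_iff)

lemma I_summable:
  "f \<in> carrier I \<Longrightarrow> (\<lambda>C. (hnorm V (f (coset_rep C)))\<^sup>2) summable_on (rcosets H)"
  by (simp add: mem_I_iff)

lemma I_value: "\<lbrakk>f \<in> carrier I; x \<in> carrier G\<rbrakk> \<Longrightarrow> f x \<in> carrier V"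
  by (simp add: I_equivariant equivariantD)

lemma I_value_rep: "\<lbrakk>f \<in> carrier I; C \<in> rcosets H\<rbrakk> \<Longrightarrow> f (coset_rep C) \<in> carrier V"
  by (simp add: I_value coset_rep_carrier)

lemma cinner_I:
  "cinner I f k = (\<Sum>\<^sub>\<infinity>C\<in>rcosets H. cinner V (f (coset_rep C)) (k (coset_rep C)))"
  by (simp add: ind_space_def)

text \<open>Cauchy-Schwarz in \<open>V\<close> and the comparison of a product with the sum of the
  squares give absolute convergence.\<close>

lemma I_cinner_summable:
  assumes f: "f \<in> carrier I" and k: "k \<in> carrier I"
  shows "(\<lambda>C. cinner V (f (coset_rep C)) (k (coset_rep C))) summable_on (rcosets H)"
proof (rule abs_summable_summable, rule summable_on_comparison_test)
  show "(\<lambda>C. (hnorm V (f (coset_rep C)))\<^sup>2 + (hnorm V (k (coset_rep C)))\<^sup>2) summable_on (rcosets H)"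
    by (intro summable_on_add I_summable f k)
  fix C assume C: "C \<in> rcosets H"
  let ?a = "hnorm V (f (coset_rep C))" and ?b = "hnorm V (k (coset_rep C))"
  have "cmod (cinner V (f (coset_rep C)) (k (coset_rep C))) \<le> ?a * ?b"
    using f k C by (intro V.cmod_cinner_le I_value_rep)
  also have "\<dots> \<le> ?a\<^sup>2 + ?b\<^sup>2"
    using sum_squares_bound[of ?a ?b] V.hnorm_nonneg[OF I_value_rep[OF f C]]
      V.hnorm_nonneg[OF I_value_rep[OF k C]] mult_nonneg_nonneg[of ?a ?b] by linarith
  finally show "cmod (cinner V (f (coset_rep C)) (k (coset_rep C))) \<le> ?a\<^sup>2 + ?b\<^sup>2" .
qed simp

lemma cinner_I_self:
  assumes f: "f \<in> carrier I"
  shows "Re (cinner I f f) = (\<Sum>\<^sub>\<infinity>C\<in>rcosets H. (hnorm V (f (coset_rep C)))\<^sup>2)"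
  unfolding cinner_I infsum_Re[OF I_cinner_summable[OF f f], symmetric]
  by (intro infsum_cong) (simp add: V.cinner_self I_value_rep f)

text \<open>The coset of \<open>x\<close> contributes one term of the squared norm, so evaluation at
  a point is bounded. Definiteness of the inner product and pointwise convergence of Cauchy
  sequences both rest on this.\<close>

lemma hnorm_value_sq_le:
  assumes f: "f \<in> carrier I" and x: "x \<in> carrier G"
  shows "(hnorm V (f x))\<^sup>2 \<le> Re (cinner I f f)"
proof -
  have "(hnorm V (f x))\<^sup>2 = (\<Sum>C\<in>{H #> x}. (hnorm V (f (coset_rep C)))\<^sup>2)"
    using equivariant_hnorm[OF I_equivariant[OF f] x coset_rep_in_rcoset[OF x]] by simp
  also have "\<dots> \<le> Re (cinner I f f)"
    unfolding cinner_I_self[OF f]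
    by (rule finite_sum_le_infsum[OF I_summable[OF f]]) (auto simp: rcosetI x)
  finally show ?thesis .
qed

lemma I_add: 
  assumes f: "f \<in> carrier I" and k: "k \<in> carrier I"
  shows "f + k \<in> carrier I"
  unfolding mem_I_iff
proof
  show "equivariant (f + k)" by (intro equivariant_add I_equivariant f k)
  show "(\<lambda>C. (hnorm V ((f + k) (coset_rep C)))\<^sup>2) summable_on (rcosets H)"
  proof (rule summable_on_comparison_test)
    show "(\<lambda>C. 2 * (hnorm V (f (coset_rep C)))\<^sup>2 + 2 * (hnorm V (k (coset_rep C)))\<^sup>2)
        summable_on (rcosets H)"
      by (intro summable_on_add summable_on_cmult_right I_summable f k)
    fix C assume C: "C \<in> rcosets H"
    let ?a = "hnorm V (f (coset_rep C))" and ?b = "hnorm V (k (coset_rep C))"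
    have "hnorm V ((f + k) (coset_rep C)) \<le> ?a + ?b"
      using f k C by (simp add: V.hnorm_triangle I_value_rep)
    then have "(hnorm V ((f + k) (coset_rep C)))\<^sup>2 \<le> (?a + ?b)\<^sup>2"
      using f k C by (intro power_mono) (simp_all add: V.hnorm_nonneg V.add_carrier I_value_rep)
    also have "\<dots> \<le> 2 * ?a\<^sup>2 + 2 * ?b\<^sup>2"
      using sum_squares_bound[of ?a ?b] by (simp add: power2_sum)
    finally show "(hnorm V ((f + k) (coset_rep C)))\<^sup>2 \<le> 2 * ?a\<^sup>2 + 2 * ?b\<^sup>2" .
  qed simp
qed

lemma I_scaleC:
  assumes f: "f \<in> carrier I"
  shows "scaleC c f \<in> carrier I"
proof -
  have "(\<lambda>C. (hnorm V (scaleC c f (coset_rep C)))\<^sup>2) summable_on (rcosets H) \<longleftrightarrow>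
      (\<lambda>C. (cmod c)\<^sup>2 * (hnorm V (f (coset_rep C)))\<^sup>2) summable_on (rcosets H)"
    by (intro summable_on_cong)
       (simp add: scaleC_fun_def V.hnorm_scaleC I_value_rep f power_mult_distrib)
  then show ?thesis
    using f by (simp add: mem_I_iff equivariant_scaleC summable_on_cmult_right)
qed

lemma I_zero: "0 \<in> carrier I"
  by (simp add: mem_I_iff equivariant_zero V.hnorm_zero)

lemma I_pre_hilbert: "pre_hilbert_space I"
proof
  show "cvec.subspace (carrier I)"
    by (auto simp: cvec.subspace_def I_zero I_add I_scaleC)
  fix f k l assume f: "f \<in> carrier I" and k: "k \<in> carrier I"
  show "cinner I (f + k) l = cinner I f l + cinner I k l" if l: "l \<in> carrier I"
  proof -
    have "cinner I (f + k) l = (\<Sum>\<^sub>\<infinity>C\<in>rcosets H. cinner V (f (coset_rep C)) (l (coset_rep C))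
        + cinner V (k (coset_rep C)) (l (coset_rep C)))"
      unfolding cinner_I by (intro infsum_cong) (simp add: V.cinner_add_left I_value_rep f k l)
    then show ?thesis
      by (simp add: cinner_I infsum_add I_cinner_summable f k l)
  qed
  show "cinner I (scaleC c f) k = c * cinner I f k" for c
    unfolding cinner_I infsum_cmult_right'[symmetric]
    by (intro infsum_cong) (simp add: V.cinner_scaleC_left I_value_rep f k scaleC_fun_def)
  show "cinner I f k = cnj (cinner I k f)"
    unfolding cinner_I infsum_cnj[symmetric]
    by (intro infsum_cong V.cinner_commute I_value_rep f k)
next
  fix f assume f: "f \<in> carrier I" and f0: "f \<noteq> 0"
  then obtain x where x: "f x \<noteq> 0" by (auto simp: fun_eq_iff)
  then have xG: "x \<in> carrier G" using f by (metis I_equivariant equivariantD(1))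
  have "0 < (hnorm V (f x))\<^sup>2"
    using x V.hnorm_eq_0_iff[OF I_value[OF f xG]] by simp
  then show "0 < Re (cinner I f f)" using hnorm_value_sq_le[OF f xG] by linarith
qed

sublocale I: pre_hilbert_space I
  by (rule I_pre_hilbert)

lemma hnorm_I_sq:
  assumes f: "f \<in> carrier I"
  shows "(hnorm I f)\<^sup>2 = (\<Sum>\<^sub>\<infinity>C\<in>rcosets H. (hnorm V (f (coset_rep C)))\<^sup>2)"
  using I.cinner_nonneg[OF f] by (simp add: hnorm_def[of I] cinner_I_self f)

lemma hnorm_value_le:
  assumes f: "f \<in> carrier I" and x: "x \<in> carrier G"
  shows "hnorm V (f x) \<le> hnorm I f"
  using hnorm_value_sq_le[OF f x] unfolding hnorm_def[of I] by (intro real_le_rsqrt)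

text \<open>As for the classical l2 spaces: take the pointwise limit \<open>L\<close>, and bound all
  finite partial sums of the squared norm of \<open>F n - L\<close> by passing to the limit in those
  of \<open>F n - F m\<close>. A uniform bound on finite partial sums gives summability and the norm
  estimate together.\<close>

lemma I_complete: "I.mcomplete"
  unfolding I.mcomplete_def
proof (intro allI impI)
  fix F assume F: "I.MCauchy F"
  have FI: "F n \<in> carrier I" for n using F by (auto simp: I.MCauchy_def)
  have cau: "\<exists>N. \<forall>n\<ge>N. \<forall>m\<ge>N. hnorm I (F n - F m) < e" if "0 < e" for e
    using F that FI by (force simp: I.MCauchy_def hdist_def)
  have "\<exists>l. limitin V.mtopology (\<lambda>n. F n x) l sequentially" if x: "x \<in> carrier G" for x
  proof -
    have "V.MCauchy (\<lambda>n. F n x)"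
      unfolding V.MCauchy_def
    proof (intro conjI allI impI)
      show "range (\<lambda>n. F n x) \<subseteq> carrier V" using I_value[OF FI x] by auto
      fix e :: real assume "0 < e"
      then obtain N where N: "\<forall>n\<ge>N. \<forall>m\<ge>N. hnorm I (F n - F m) < e" using cau by blast
      show "\<exists>N. \<forall>n n'. N \<le> n \<longrightarrow> N \<le> n' \<longrightarrow> hdist V (F n x) (F n' x) < e"
      proof (intro exI allI impI)
        fix n m assume "N \<le> n" "N \<le> m"
        then have "hnorm I (F n - F m) < e" using N by simp
        then show "hdist V (F n x) (F m x) < e"
          using hnorm_value_le[OF I.diff_carrier[OF FI FI] x, of n m] I_value[OF FI x]
          by (simp add: hdist_def)
      qed
    qed
    then show ?thesis using V.complete V.mcomplete_def by blast
  qed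
  then obtain L0 where L0: "\<And>x. x \<in> carrier G \<Longrightarrow> limitin V.mtopology (\<lambda>n. F n x) (L0 x) sequentially"
    by metis
  define L where "L x = (if x \<in> carrier G then L0 x else 0)" for x
  have L: "limitin V.mtopology (\<lambda>n. F n x) (L x) sequentially" if "x \<in> carrier G" for x
    using that L0 by (simp add: L_def)
  have LV: "L x \<in> carrier V" if "x \<in> carrier G" for x
    using L[OF that] V.limitin_mspace by blast
  have Llim: "(\<lambda>n. hnorm V (F n x - L x)) \<longlonglongrightarrow> 0" if "x \<in> carrier G" for x
    by (intro V.limitin_hnorm_diff L I_value FI that)
  have eqL: "equivariant L"
    unfolding equivariant_def
  proof (intro conjI allI impI ballI)
    show "L x = 0" if "x \<notin> carrier G" for x using that by (simp add: L_def)
    show "L x \<in> carrier V" if "x \<in> carrier G" for x using that by (rule LV)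
    fix h x assume h: "h \<in> H" and x: "x \<in> carrier G"
    have hx: "h \<otimes> x \<in> carrier G" by (simp add: H_carrier h x)
    have sv: "\<sigma> h (L x) \<in> carrier V" by (intro sigma_carrier h LV x)
    \<comment> \<open>Both vectors are limits of
      \<open>F n (h \<otimes> x) = \<sigma> h (F n x)\<close>, the second one because
      \<open>\<sigma> h\<close> is isometric.\<close>
    have "hnorm V (L (h \<otimes> x) - \<sigma> h (L x))
        \<le> hnorm V (F n (h \<otimes> x) - L (h \<otimes> x)) + hnorm V (F n x - L x)" for n
    proof -
      have "F n (h \<otimes> x) - \<sigma> h (L x) = \<sigma> h (F n x - L x)"
        using h x FI[of n] LV[OF x]
        by (simp add: equivariantD(3)[OF I_equivariant] sigma_diff I_value)
      then have "hnorm V (F n (h \<otimes> x) - \<sigma> h (L x)) = hnorm V (F n x - L x)"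
        using h x FI[of n] LV[OF x] by (simp add: sigma_hnorm V.diff_carrier I_value)
      then show ?thesis
        using V.hnorm_diff_triangle[OF LV[OF hx] I_value[OF FI[of n] hx] sv]
          V.hnorm_diff_commute[OF LV[OF hx] I_value[OF FI[of n] hx]] by simp
    qed
    moreover have "(\<lambda>n. hnorm V (F n (h \<otimes> x) - L (h \<otimes> x)) + hnorm V (F n x - L x)) \<longlonglongrightarrow> 0 + 0"
      by (intro tendsto_add Llim hx x)
    ultimately have "hnorm V (L (h \<otimes> x) - \<sigma> h (L x)) \<le> 0 + 0"
      by (intro LIMSEQ_le_const) auto
    then show "L (h \<otimes> x) = \<sigma> h (L x)"
      using V.hnorm_nonneg[OF V.diff_carrier[OF LV[OF hx] sv]]
        V.hnorm_eq_0_iff[OF V.diff_carrier[OF LV[OF hx] sv]] by simp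
  qed
  have near: "\<exists>N. \<forall>n\<ge>N. F n - L \<in> carrier I \<and> hnorm I (F n - L) \<le> e" if e: "0 < e" for e
  proof -
    obtain N where N: "\<forall>n\<ge>N. \<forall>m\<ge>N. hnorm I (F n - F m) < e" using cau e by blast
    have "F n - L \<in> carrier I \<and> hnorm I (F n - L) \<le> e" if n: "N \<le> n" for n
    proof -
      \<comment> \<open>Only finitely many terms occur, so the limit in \<open>m\<close> may be
        taken term by term; before the limit the sum is at most the squared distance of
        \<open>F n\<close> and \<open>F m\<close>.\<close>
      have fin: "(\<Sum>C\<in>A. (hnorm V ((F n - L) (coset_rep C)))\<^sup>2) \<le> e\<^sup>2"
        if A: "finite A" "A \<subseteq> rcosets H" for A
      proof (rule LIMSEQ_le_const2)
        show "(\<lambda>m. \<Sum>C\<in>A. (hnorm V ((F n - F m) (coset_rep C)))\<^sup>2)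
            \<longlonglongrightarrow> (\<Sum>C\<in>A. (hnorm V ((F n - L) (coset_rep C)))\<^sup>2)"
        proof (intro tendsto_sum tendsto_power)
          fix C assume "C \<in> A"
          then have c: "coset_rep C \<in> carrier G" (is "?c \<in> _") using A coset_rep_carrier by auto
          have FV: "F m ?c \<in> carrier V" for m by (rule I_value[OF FI c])
          show "(\<lambda>m. hnorm V ((F n - F m) ?c)) \<longlonglongrightarrow> hnorm V ((F n - L) ?c)"
          proof (rule LIM_zero_cancel, rule Lim_null_comparison[OF _ Llim[OF c]],
              intro always_eventually allI)
            fix m
            show "norm (hnorm V ((F n - F m) ?c) - hnorm V ((F n - L) ?c)) \<le> hnorm V (F m ?c - L ?c)"
              using V.hnorm_diff_triangle[OF FV[of n] FV[of m] LV[OF c]]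
                V.hnorm_diff_triangle[OF FV[of n] LV[OF c] FV[of m]]
                V.hnorm_diff_commute[OF FV[of m] LV[OF c]] by simp
          qed
        qed
        show "\<exists>M. \<forall>m\<ge>M. (\<Sum>C\<in>A. (hnorm V ((F n - F m) (coset_rep C)))\<^sup>2) \<le> e\<^sup>2"
        proof (intro exI allI impI)
          fix m assume m: "N \<le> m"
          have d: "F n - F m \<in> carrier I" by (intro I.diff_carrier FI)
          have "(\<Sum>C\<in>A. (hnorm V ((F n - F m) (coset_rep C)))\<^sup>2) \<le> (hnorm I (F n - F m))\<^sup>2"
            unfolding hnorm_I_sq[OF d] using A by (intro finite_sum_le_infsum I_summable d) auto
          also have "\<dots> \<le> e\<^sup>2"
            using N n m by (intro power_mono I.hnorm_nonneg d) (auto intro: less_imp_le)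
          finally show "(\<Sum>C\<in>A. (hnorm V ((F n - F m) (coset_rep C)))\<^sup>2) \<le> e\<^sup>2" .
        qed
      qed
      have sm: "(\<lambda>C. (hnorm V ((F n - L) (coset_rep C)))\<^sup>2) summable_on (rcosets H)"
        using fin by (intro nonneg_bdd_above_summable_on) (auto intro!: bdd_aboveI2)
      have "equivariant (F n - L)"
        using equivariant_add[OF I_equivariant[OF FI[of n]] equivariant_scaleC[OF eqL, of "-1"]]
        by (simp add: cvec.scale_minus_left scaleC_one)
      then have d: "F n - L \<in> carrier I" using sm by (simp add: mem_I_iff)
      have "(hnorm I (F n - L))\<^sup>2 \<le> e\<^sup>2"
        unfolding hnorm_I_sq[OF d] by (intro infsum_le_finite_sums sm fin)
      then show ?thesis using d e by (simp add: power2_le_iff_abs_le)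
    qed
    then show ?thesis by blast
  qed
  obtain n where "F n - L \<in> carrier I" using near[of 1] by auto
  \<comment> \<open>\<open>L\<close> is the difference of \<open>F n\<close> and
    \<open>F n - L\<close>.\<close>
  then have LI: "L \<in> carrier I" using I.diff_carrier[OF FI[of n]] by fastforce
  have "limitin I.mtopology F L sequentially"
    unfolding I.limit_metric_sequentially
  proof (intro conjI LI allI impI)
    fix e :: real assume e: "0 < e"
    then obtain N where "\<forall>n\<ge>N. hnorm I (F n - L) \<le> e / 2" using near[of "e / 2"] by auto
    then show "\<exists>N. \<forall>n\<ge>N. F n \<in> carrier I \<and> hdist I (F n) L < e"
      using e FI LI by (force simp: hdist_def)
  qed
  then show "\<exists>l. limitin I.mtopology F l sequentially" by blast
qed

sublocale I: hilbert_space I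
  by unfold_locales (rule I_complete)

end

subsection \<open>Transport of structure\<close>

text \<open>A change of variable \<open>b\<close> on the group combined with a change of
  coefficients \<open>U\<close>. Right translation is the case of a trivial \<open>U\<close>; the
  passage to a conjugate subgroup uses left translation together with an intertwiner.\<close>

definition transport ::
    "('g, 'x) monoid_scheme \<Rightarrow> ('g \<Rightarrow> 'g) \<Rightarrow> ('v \<Rightarrow> 'w) \<Rightarrow> ('g \<Rightarrow> 'v) \<Rightarrow> 'g \<Rightarrow> 'w::zero" where
  "transport G b U f = (\<lambda>x. if x \<in> carrier G then U (f (b x)) else 0)"

text \<open>\<open>b_mult\<close> makes \<open>b\<close> carry cosets of \<open>K\<close> to cosets
  of \<open>H\<close>, with \<theta> as the resulting comparison of the subgroups;
  \<open>U_sigma\<close> is the matching compatibility of the coefficients. Together they turn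
  \<open>H\<close>-equivariant functions into \<open>K\<close>-equivariant ones.\<close>

locale rep_transport =
  A: induced_rep G V H \<sigma> + B: induced_rep G W K \<tau>
  for G :: "('g, 'x) monoid_scheme" (structure)
    and V :: "('v::complex_vector, 'y) hspace_scheme" and H and \<sigma> :: "'g \<Rightarrow> 'v \<Rightarrow> 'v"
    and W :: "('w::complex_vector, 'z) hspace_scheme" and K and \<tau> :: "'g \<Rightarrow> 'w \<Rightarrow> 'w" +
  fixes b \<theta> :: "'g \<Rightarrow> 'g" and U :: "'v \<Rightarrow> 'w"
  assumes U: "unitary_map V W U"
    and b: "bij_betw b (carrier G) (carrier G)"
    and theta: "bij_betw \<theta> K H"
    and b_mult: "\<lbrakk>h \<in> K; x \<in> carrier G\<rbrakk> \<Longrightarrow> b (h \<otimes> x) = \<theta> h \<otimes> b x"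
    and U_sigma: "\<lbrakk>h \<in> K; v \<in> carrier V\<rbrakk> \<Longrightarrow> U (\<sigma> (\<theta> h) v) = \<tau> h (U v)"
begin

lemma b_carrier: "x \<in> carrier G \<Longrightarrow> b x \<in> carrier G"
  using b by (rule bij_betw_apply)

lemma theta_mem: "h \<in> K \<Longrightarrow> \<theta> h \<in> H"
  using theta by (rule bij_betw_apply)

lemma b_coset:
  assumes "C \<in> rcosets K" and "x \<in> C" shows "b x \<in> H #> b (coset_rep C)"
proof -
  have c: "coset_rep C \<in> carrier G" using assms(1) by (rule B.coset_rep_carrier)
  have "x \<in> K #> coset_rep C"
    using assms B.coset_eq[OF assms(1) B.coset_rep_mem[OF assms(1)]] by simp
  then obtain h where "h \<in> K" "x = h \<otimes> coset_rep C" by (auto simp: r_coset_def)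
  then show ?thesis by (auto simp: r_coset_def b_mult c theta_mem)
qed

text \<open>The map is written with \<open>coset_rep\<close> because the norms are sums over chosen
  representatives. The image of a chosen representative lies in the right coset but is in general
  not the representative chosen there.\<close>

lemma rcosets_bij: "bij_betw (\<lambda>C. H #> b (coset_rep C)) (rcosets K) (rcosets H)"
  unfolding bij_betw_def
proof
  show "inj_on (\<lambda>C. H #> b (coset_rep C)) (rcosets K)"
  proof
    fix C D assume C: "C \<in> rcosets K" and D: "D \<in> rcosets K"
      and eq: "H #> b (coset_rep C) = H #> b (coset_rep D)"
    note c = B.coset_rep_carrier[OF C] and d = B.coset_rep_carrier[OF D]
    have "b (coset_rep C) \<in> H #> b (coset_rep D)"
      using eq A.rcos_self[OF b_carrier[OF c] A.sub] by simp
    then obtain h where h: "h \<in> H" "b (coset_rep C) = h \<otimes> b (coset_rep D)"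
      by (auto simp: r_coset_def)
    obtain k where k: "k \<in> K" "h = \<theta> k"
      using h(1) theta by (auto simp: bij_betw_def)
    have "b (coset_rep C) = b (k \<otimes> coset_rep D)" using h k d by (simp add: b_mult)
    then have "coset_rep C = k \<otimes> coset_rep D"
      using b c d k by (auto simp: bij_betw_def B.H_carrier dest: inj_onD)
    then have "coset_rep C \<in> K #> coset_rep D" using k by (auto simp: r_coset_def)
    then have "coset_rep C \<in> D" using B.coset_eq[OF D B.coset_rep_mem[OF D]] by simp
    then show "C = D" using B.coset_eq[OF C B.coset_rep_mem[OF C]] B.coset_eq[OF D] by simp
  qed
  show "(\<lambda>C. H #> b (coset_rep C)) ` (rcosets K) = rcosets H"
  proof
    show "(\<lambda>C. H #> b (coset_rep C)) ` (rcosets K) \<subseteq> rcosets H"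
      by (auto intro!: A.rcosetI b_carrier B.coset_rep_carrier)
    show "rcosets H \<subseteq> (\<lambda>C. H #> b (coset_rep C)) ` (rcosets K)"
    proof
      fix D assume D: "D \<in> rcosets H"
      obtain x where x: "x \<in> carrier G" "b x = coset_rep D"
        using A.coset_rep_carrier[OF D] b unfolding bij_betw_def by (metis imageE)
      have C: "K #> x \<in> rcosets K" using x by (intro B.rcosetI)
      have "b x \<in> H #> b (coset_rep (K #> x))"
        by (intro b_coset C A.rcos_self x B.sub)
      then have "H #> b x = H #> b (coset_rep (K #> x))"
        by (intro A.coset_eq A.rcosetI b_carrier B.coset_rep_carrier C)
      moreover have "H #> b x = D" using A.coset_eq[OF D A.coset_rep_mem[OF D]] x by simp
      ultimately show "D \<in> (\<lambda>C. H #> b (coset_rep C)) ` (rcosets K)" using C by blast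
    qed
  qed
qed

lemma transport_equivariant:
  assumes "A.equivariant f" shows "B.equivariant (transport G b U f)"
  using A.equivariantD[OF assms]
  by (auto simp: B.equivariant_def transport_def b_mult B.H_carrier theta_mem b_carrier U_sigma
      intro: unitary_mapD(2)[OF U])

text \<open>\<open>b (coset_rep C)\<close> and the representative chosen for its coset give the same
  inner product, since inner products of equivariant functions are constant on cosets.\<close>

lemma cinner_transport_rep:
  assumes f: "A.equivariant f" and k: "A.equivariant k" and C: "C \<in> rcosets K"
  shows "cinner W (transport G b U f (coset_rep C)) (transport G b U k (coset_rep C))
    = cinner V (f (coset_rep (H #> b (coset_rep C)))) (k (coset_rep (H #> b (coset_rep C))))"
  using C A.equivariantD(2)[OF f] A.equivariantD(2)[OF k]
    A.equivariant_cinner[OF f k _ A.coset_rep_in_rcoset]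
  by (simp add: transport_def B.coset_rep_carrier b_carrier unitary_mapD(5)[OF U])

lemma transport_mem:
  assumes f: "f \<in> carrier A.I" shows "transport G b U f \<in> carrier B.I"
proof -
  note fe = A.I_equivariant[OF f]
  have "(\<lambda>C. (hnorm V (f (coset_rep (H #> b (coset_rep C)))))\<^sup>2) summable_on (rcosets K)"
    using A.I_summable[OF f] summable_on_reindex_bij_betw[OF rcosets_bij] by fastforce
  then show ?thesis
    by (simp add: B.mem_I_iff transport_equivariant fe hnorm_def cinner_transport_rep[OF fe fe]
        cong: summable_on_cong)
qed

lemma cinner_transport:
  assumes f: "f \<in> carrier A.I" and k: "k \<in> carrier A.I"
  shows "cinner B.I (transport G b U f) (transport G b U k) = cinner A.I f k"
  unfolding B.cinner_I A.cinner_I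
  using A.I_equivariant[OF f] A.I_equivariant[OF k]
  by (subst infsum_reindex_bij_betw[OF rcosets_bij, symmetric])
     (intro infsum_cong cinner_transport_rep)

end

text \<open>Inverting all the data at once supplies the inverse map, and with it the surjectivity,
  in \<open>transport_unitary\<close>.\<close>

lemma rep_transport_inverse:
  fixes G (structure)
  assumes "rep_transport G V H \<sigma> W K \<tau> b \<theta> U"
  shows "rep_transport G W K \<tau> V H \<sigma> (inv_into (carrier G) b) (inv_into K \<theta>) (inv_into (carrier V) U)"
proof -
  interpret rep_transport G V H \<sigma> W K \<tau> b \<theta> U by fact
  have Ub: "bij_betw U (carrier V) (carrier W)" by (rule unitary_mapD(1)[OF U])
  let ?b = "inv_into (carrier G) b" and ?t = "inv_into K \<theta>" and ?U = "inv_into (carrier V) U"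
  note bij = Ub b theta
  have U': "?U v \<in> carrier V" "U (?U v) = v" if "v \<in> carrier W" for v
    using Ub that by (simp_all add: bij_betw_def inv_into_into f_inv_into_f)
  have U'': "?U (U v) = v" if "v \<in> carrier V" for v
    using Ub that by (simp add: bij_betw_def)
  have b': "?b v \<in> carrier G" "b (?b v) = v" "?b (b v) = v" if "v \<in> carrier G" for v
    using b that by (simp_all add: bij_betw_def inv_into_into f_inv_into_f)
  have t': "?t v \<in> K" "\<theta> (?t v) = v" if "v \<in> H" for v
    using theta that by (simp_all add: bij_betw_def inv_into_into f_inv_into_f)
  show ?thesis
  proof
    show "unitary_map W V ?U"
      unfolding unitary_map_def
    proof (intro conjI ballI allI)
      show "bij_betw ?U (carrier W) (carrier V)" by (rule bij_betw_inv_into[OF Ub])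
      fix x assume x: "x \<in> carrier W"
      show "?U (scaleC c x) = scaleC c (?U x)" for c
        using U''[of "scaleC c (?U x)"] U'[OF x]
        by (simp add: unitary_mapD(4)[OF U] A.V.scaleC_carrier)
      fix y assume y: "y \<in> carrier W"
      show "?U (x + y) = ?U x + ?U y"
        using U''[of "?U x + ?U y"] U'[OF x] U'[OF y]
        by (simp add: unitary_mapD(3)[OF U] A.V.add_carrier)
      show "cinner V (?U x) (?U y) = cinner W x y"
        using unitary_mapD(5)[OF U, of "?U x" "?U y"] U'[OF x] U'[OF y] by simp
    qed
    show "bij_betw ?b (carrier G) (carrier G)" by (rule bij_betw_inv_into[OF b])
    show "bij_betw ?t H K" by (rule bij_betw_inv_into[OF theta])
    fix h assume h: "h \<in> H"
    show "?b (h \<otimes> x) = ?t h \<otimes> ?b x" if x: "x \<in> carrier G" for x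
      using b_mult[OF t'(1)[OF h] b'(1)[OF x]] b'(3)[of "?t h \<otimes> ?b x"] t'[OF h] b'[OF x]
      by (simp add: B.H_carrier)
    show "?U (\<tau> (?t h) v) = \<sigma> h (?U v)" if v: "v \<in> carrier W" for v
      using U_sigma[OF t'(1)[OF h] U'(1)[OF v]] U''[of "\<sigma> h (?U v)"] t'[OF h] U'[OF v] h
      by (simp add: A.sigma_carrier)
  qed
qed

lemma (in rep_transport) transport_unitary: "unitary_map A.I B.I (transport G b U)"
proof -
  interpret R: rep_transport G W K \<tau> V H \<sigma> "inv_into (carrier G) b" "inv_into K \<theta>"
    "inv_into (carrier V) U"
    by (rule rep_transport_inverse) (rule rep_transport_axioms)
  let ?R = "transport G (inv_into (carrier G) b) (inv_into (carrier V) U)"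
  have Ub: "bij_betw U (carrier V) (carrier W)" by (rule unitary_mapD(1)[OF U])
  have ib: "inv_into (carrier G) b x \<in> carrier G" "b (inv_into (carrier G) b x) = x"
    "inv_into (carrier G) b (b x) = x" if "x \<in> carrier G" for x
    using b that by (simp_all add: bij_betw_def inv_into_into f_inv_into_f)
  show ?thesis
    unfolding unitary_map_def
  proof (intro conjI ballI allI)
    show "bij_betw (transport G b U) (carrier A.I) (carrier B.I)"
    proof (rule bij_betw_byWitness[where f' = ?R])
      show "\<forall>f\<in>carrier A.I. ?R (transport G b U f) = f"
      proof (intro ballI ext)
        fix f x assume f: "f \<in> carrier A.I"
        show "?R (transport G b U f) x = f x"
        proof (cases "x \<in> carrier G")
          case True
          then show ?thesis
            using A.I_value[OF f True] Ub by (simp add: transport_def ib bij_betw_def)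
        qed (use A.equivariantD(1)[OF A.I_equivariant[OF f]] in \<open>simp add: transport_def\<close>)
      qed
      show "\<forall>f\<in>carrier B.I. transport G b U (?R f) = f"
      proof (intro ballI ext)
        fix f x assume f: "f \<in> carrier B.I"
        show "transport G b U (?R f) x = f x"
        proof (cases "x \<in> carrier G")
          case True
          then show ?thesis
            using B.I_value[OF f True] Ub
            by (simp add: transport_def ib b_carrier bij_betw_def f_inv_into_f)
        qed (use B.equivariantD(1)[OF B.I_equivariant[OF f]] in \<open>simp add: transport_def\<close>)
      qed
    qed (auto simp: transport_mem R.transport_mem)
    fix f assume f: "f \<in> carrier A.I"
    show "transport G b U (scaleC c f) = scaleC c (transport G b U f)" for c
      using A.I_value[OF f b_carrier]
      by (auto simp: transport_def scaleC_fun_def fun_eq_iff unitary_mapD(4)[OF U])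
    fix k assume k: "k \<in> carrier A.I"
    show "transport G b U (f + k) = transport G b U f + transport G b U k"
      using A.I_value[OF f b_carrier] A.I_value[OF k b_carrier]
      by (auto simp: transport_def fun_eq_iff unitary_mapD(3)[OF U])
    show "cinner B.I (transport G b U f) (transport G b U k) = cinner A.I f k"
      by (rule cinner_transport[OF f k])
  qed
qed

subsection \<open>The induced representation is unitary\<close>

context induced_rep
begin

lemma right_mult_bij:
  assumes "g \<in> carrier G" shows "bij_betw (\<lambda>x. x \<otimes> g) (carrier G) (carrier G)"
  using assms by (intro bij_betw_byWitness[where f' = "\<lambda>x. x \<otimes> inv g"]) (auto simp: m_assoc)

lemma ind_rep_eq: "f \<in> carrier I \<Longrightarrow> \<pi> g f = transport G (\<lambda>x. x \<otimes> g) (\<lambda>v. v) f"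
  by (simp add: ind_rep_def transport_def)

lemma ind_rep_apply: "\<lbrakk>f \<in> carrier I; x \<in> carrier G\<rbrakk> \<Longrightarrow> \<pi> g f x = f (x \<otimes> g)"
  by (simp add: ind_rep_def)

lemma ind_rep_unitary:
  assumes g: "g \<in> carrier G" shows "unitary_map I I (\<pi> g)"
proof -
  interpret T: rep_transport G V H \<sigma> V H \<sigma> "\<lambda>x. x \<otimes> g" "\<lambda>h. h" "\<lambda>v. v"
  proof
    show "unitary_map V V (\<lambda>v. v)" by (simp add: unitary_map_def bij_betw_def)
    show "bij_betw (\<lambda>x. x \<otimes> g) (carrier G) (carrier G)" by (rule right_mult_bij[OF g])
  qed (auto simp: m_assoc g H_carrier bij_betw_def)
  have "bij_betw (\<pi> g) (carrier I) (carrier I)"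
    using unitary_mapD(1)[OF T.transport_unitary] by (simp add: ind_rep_eq cong: bij_betw_cong)
  then show ?thesis
    using T.transport_unitary
    by (simp add: unitary_map_def ind_rep_eq I.add_carrier I.scaleC_carrier)
qed

lemmas ind_rep_carrier = unitary_mapD(2)[OF ind_rep_unitary]
  and ind_rep_add = unitary_mapD(3)[OF ind_rep_unitary]
  and ind_rep_cinner = unitary_mapD(5)[OF ind_rep_unitary]

lemma ind_rep_mult:
  assumes g: "g \<in> carrier G" and h: "h \<in> carrier G" and f: "f \<in> carrier I"
  shows "\<pi> (g \<otimes> h) f = \<pi> g (\<pi> h f)"
proof
  fix x
  show "\<pi> (g \<otimes> h) f x = \<pi> g (\<pi> h f) x"
    using ind_rep_carrier[OF h f] f g h
    by (cases "x \<in> carrier G") (simp_all add: ind_rep_apply m_assoc, simp add: ind_rep_def)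
qed

lemma ind_rep_one:
  assumes f: "f \<in> carrier I" shows "\<pi> \<one> f = f"
  using equivariantD(1)[OF I_equivariant[OF f]] f by (auto simp: ind_rep_def fun_eq_iff)

lemma ind_rep_inv:
  assumes g: "g \<in> carrier G" and f: "f \<in> carrier I"
  shows "\<pi> g (\<pi> (inv g) f) = f" and "\<pi> (inv g) (\<pi> g f) = f"
  using ind_rep_mult[of g "inv g" f] ind_rep_mult[of "inv g" g f] g f by (simp_all add: ind_rep_one)

lemma ind_rep_diff:
  "\<lbrakk>g \<in> carrier G; f \<in> carrier I; k \<in> carrier I\<rbrakk> \<Longrightarrow> \<pi> g (f - k) = \<pi> g f - \<pi> g k"
  using ind_rep_add[of g "f - k" k] I.diff_carrier[of f k] by simp

lemma ind_rep_unitary_rep: "unitary_rep G I \<pi>"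
  unfolding unitary_rep_def
proof
  show "hilbert_space I" by (rule I.hilbert_space_axioms)
  have B: "\<pi> g \<in> Bij (carrier I)" if "g \<in> carrier G" for g
    using unitary_mapD(1)[OF ind_rep_unitary[OF that]] by (simp add: Bij_def ind_rep_def)
  show "\<pi> \<in> hom G (unitary_group I)"
  proof (rule homI)
    show "\<pi> g \<in> carrier (unitary_group I)" if "g \<in> carrier G" for g
      using B ind_rep_unitary that by (simp add: unitary_group_def)
    show "\<pi> (g \<otimes> h) = \<pi> g \<otimes>\<^bsub>unitary_group I\<^esub> \<pi> h" if g: "g \<in> carrier G" and h: "h \<in> carrier G" for g h
    proof -
      have "\<pi> (g \<otimes> h) = compose (carrier I) (\<pi> g) (\<pi> h)"
        using ind_rep_mult[OF g h] B[of "g \<otimes> h"] g h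
        by (intro extensionalityI[where A = "carrier I"]) (auto simp: Bij_def compose_def)
      then show ?thesis using B g h by (simp add: unitary_group_def BijGroup_def)
    qed
  qed
qed

section \<open>Functions supported on a single coset\<close>

lemma cinner_I_single:
  assumes f: "f \<in> carrier I" and k: "k \<in> carrier I" and y: "y \<in> carrier G"
    and zero: "\<And>x. \<lbrakk>x \<in> carrier G; x \<notin> H #> y\<rbrakk> \<Longrightarrow> k x = 0"
  shows "cinner I f k = cinner V (f y) (k y)"
proof -
  have "cinner I f k = (\<Sum>\<^sub>\<infinity>C\<in>{H #> y}. cinner V (f (coset_rep C)) (k (coset_rep C)))"
    unfolding cinner_I
  proof (rule infsum_cong_neutral)
    fix C assume C: "C \<in> rcosets H - {H #> y}"
    then have "coset_rep C \<notin> H #> y"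
      using coset_eq[of C "coset_rep C"] coset_eq[of "H #> y" "coset_rep C"]
        coset_rep_mem rcosetI[OF y] by auto
    then show "cinner V (f (coset_rep C)) (k (coset_rep C)) = 0"
      using C f by (simp add: zero coset_rep_carrier V.cinner_zero_right I_value_rep)
  qed (use rcosetI[OF y] in auto)
  then show ?thesis
    by (simp add: equivariant_cinner I_equivariant f k y coset_rep_in_rcoset)
qed

text \<open>The copy of \<open>V\<close> inside \<open>I\<close> that lives on the trivial coset. By
  \<open>cinner_delta\<close> its adjoint is evaluation at \<open>\<one>\<close>, which is how
  values are recovered from inner products.\<close>

definition delta :: "'v \<Rightarrow> 'g \<Rightarrow> 'v" where
  "delta v = (\<lambda>x. if x \<in> H then \<sigma> x v else 0)"

lemma delta_mem:
  assumes v: "v \<in> carrier V" shows "delta v \<in> carrier I"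
proof -
  have "equivariant (delta v)"
    using v by (auto simp: equivariant_def delta_def H_carrier sigma_carrier V.zero_carrier sigma_mult
        mult_mem_iff sigma_zero)
  moreover have "(\<lambda>C. (hnorm V (delta v (coset_rep C)))\<^sup>2) summable_on (rcosets H)"
  proof (rule finite_nonzero_values_imp_summable_on, rule finite_subset)
    show "{C \<in> rcosets H. (hnorm V (delta v (coset_rep C)))\<^sup>2 \<noteq> 0} \<subseteq> {H}"
    proof
      fix C assume C: "C \<in> {C \<in> rcosets H. (hnorm V (delta v (coset_rep C)))\<^sup>2 \<noteq> 0}"
      then have "coset_rep C \<in> H" by (auto simp: delta_def V.hnorm_zero split: if_splits)
      then have "H #> coset_rep C = H" by (intro coset_join2 sub H_carrier)
      then show "C \<in> {H}" using C coset_eq coset_rep_mem by auto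
    qed
  qed simp
  ultimately show ?thesis by (simp add: mem_I_iff)
qed

lemma delta_one: "v \<in> carrier V \<Longrightarrow> delta v \<one> = v"
  by (simp add: delta_def H_one sigma_one)

lemma delta_add: "\<lbrakk>v \<in> carrier V; w \<in> carrier V\<rbrakk> \<Longrightarrow> delta (v + w) = delta v + delta w"
  by (auto simp: delta_def sigma_add fun_eq_iff)

lemma delta_scaleC: "v \<in> carrier V \<Longrightarrow> delta (scaleC c v) = scaleC c (delta v)"
  by (auto simp: delta_def sigma_scaleC fun_eq_iff scaleC_fun_def)

lemma delta_zero: "delta 0 = 0"
  by (auto simp: delta_def sigma_zero fun_eq_iff)

text \<open>Right translation by \<open>h \<in> H\<close> preserves the trivial coset, so
  \<open>H\<close> acts on the copy of \<open>V\<close> by \<sigma> itself. This makes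
  \<open>delta\<close> an \<open>H\<close>-intertwiner.\<close>

lemma delta_sigma:
  assumes h: "h \<in> H" and v: "v \<in> carrier V" shows "delta (\<sigma> h v) = \<pi> h (delta v)"
proof
  fix x
  show "delta (\<sigma> h v) x = \<pi> h (delta v) x"
  proof (cases "x \<in> carrier G")
    case True
    then have "x \<otimes> h \<in> H \<longleftrightarrow> x \<in> H"
      using h by (metis H_carrier H_inv H_mult inv_closed m_assoc r_inv r_one)
    then show ?thesis
      using True delta_mem[OF v] h v by (simp add: ind_rep_apply delta_def sigma_mult)
  qed (use H_carrier delta_mem[OF v] in \<open>auto simp: delta_def ind_rep_def\<close>)
qed

lemma cinner_delta:
  assumes f: "f \<in> carrier I" and v: "v \<in> carrier V"
  shows "cinner I f (delta v) = cinner V (f \<one>) v"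
  using cinner_I_single[OF f delta_mem[OF v], of \<one>] v sub
  by (simp add: delta_one) (simp add: delta_def subgroup.subset)

text \<open>Translation moves the value at \<open>x\<close> to \<open>\<one>\<close>. Hence a
  function orthogonal to all translates of the copy of \<open>V\<close> is \<open>0\<close>.\<close>

lemma cinner_translate_delta:
  assumes f: "f \<in> carrier I" and v: "v \<in> carrier V" and x: "x \<in> carrier G"
  shows "cinner I f (\<pi> (inv x) (delta v)) = cinner V (f x) v"
proof -
  have "cinner I f (\<pi> (inv x) (delta v)) = cinner I (\<pi> x f) (delta v)"
    using ind_rep_cinner[of "inv x" "\<pi> x f" "delta v"] f v x
    by (simp add: ind_rep_inv ind_rep_carrier delta_mem)
  also have "\<dots> = cinner V (f x) v"
    using f v x by (simp add: cinner_delta ind_rep_carrier ind_rep_apply)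
  finally show ?thesis .
qed

lemma eq_delta:
  assumes f: "f \<in> carrier I" and "\<And>x. \<lbrakk>x \<in> carrier G; x \<notin> H\<rbrakk> \<Longrightarrow> f x = 0"
  shows "f = delta (f \<one>)"
proof
  fix x
  show "f x = delta (f \<one>) x"
    using assms(2)[of x] equivariantD(1)[OF I_equivariant[OF f], of x]
      equivariantD(3)[OF I_equivariant[OF f], of x \<one>] H_carrier[of x]
    by (auto simp: delta_def)
qed

end

subsection \<open>Intertwiners vanish on infinite orbits\<close>

text \<open>Two maps play the role of \<open>T\<close>: \<open>delta\<close> followed by the
  projection onto an invariant subspace, with both inducing representations equal, and
  \<open>delta\<close> followed by a unitary equivalence.\<close>

locale intertwiner =
  A: induced_rep G V H \<sigma> + B: induced_rep G W K \<tau>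
  for G :: "('g, 'x) monoid_scheme" (structure)
    and V :: "('v::complex_vector, 'y) hspace_scheme" and H and \<sigma> :: "'g \<Rightarrow> 'v \<Rightarrow> 'v"
    and W :: "('w::complex_vector, 'z) hspace_scheme" and K and \<tau> :: "'g \<Rightarrow> 'w \<Rightarrow> 'w" +
  fixes T :: "'v \<Rightarrow> 'g \<Rightarrow> 'w"
  assumes fd: "finite_dimensional V"
    and T_mem: "v \<in> carrier V \<Longrightarrow> T v \<in> carrier B.I"
    and T_add: "\<lbrakk>v \<in> carrier V; w \<in> carrier V\<rbrakk> \<Longrightarrow> T (v + w) = T v + T w"
    and T_scaleC: "v \<in> carrier V \<Longrightarrow> T (scaleC c v) = scaleC c (T v)"
    and T_sigma: "\<lbrakk>h \<in> H; v \<in> carrier V\<rbrakk> \<Longrightarrow> T (\<sigma> h v) = B.\<pi> h (T v)"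
begin

lemma T_zero: "T 0 = 0"
  using T_add[of 0 0] A.V.zero_carrier by simp

lemma T_sum: "(\<And>i. i \<in> E \<Longrightarrow> f i \<in> carrier V) \<Longrightarrow> T (sum f E) = (\<Sum>i\<in>E. T (f i))"
  by (induction E rule: infinite_finite_induct) (simp_all add: T_zero T_add A.V.sum_carrier)

text \<open>If \<open>T v x \<noteq> 0\<close>, the bound \<open>cle\<close> forces every coset of
  the orbit into one of the superlevel sets \<open>S e\<close>. These are finitely many, and each is
  finite by square summability.\<close>

lemma vanish_on_infinite_orbit:
  assumes x: "x \<in> carrier G" and v: "v \<in> carrier V"
    and inf: "infinite ((\<lambda>h. K #> (x \<otimes> h)) ` H)"
  shows "T v x = 0"
proof (rule ccontr)
  assume nz: "T v x \<noteq> 0"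
  obtain E where E: "finite E" "A.V.orthonormal E" "cvec.span E = carrier V"
    using A.V.finite_dimensional_orthonormal_basis[OF fd] .
  have sub: "E \<subseteq> carrier V" using E by (simp add: A.V.orthonormal_def)
  have TE: "T e \<in> carrier B.I" if "e \<in> E" for e using that sub T_mem by auto
  have en: "hnorm V e = 1" if "e \<in> E" for e
    using E(2) that by (simp add: A.V.orthonormal_def hnorm_def)
  define c where "c = hnorm W (T v x)"
  have c: "0 < c"
    using nz B.V.hnorm_nonneg[OF B.I_value[OF T_mem[OF v] x]]
      B.V.hnorm_eq_0_iff[OF B.I_value[OF T_mem[OF v] x]] by (simp add: c_def)
  have cle: "c \<le> (\<Sum>e\<in>E. hnorm V v * hnorm W (T e (x \<otimes> h)))" if h: "h \<in> H" for h
  proof -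
    have hG: "h \<in> carrier G" by (rule A.H_carrier[OF h])
    \<comment> \<open>Since \<open>v = \<sigma> h w\<close>, the intertwining property shifts the
      argument from \<open>x\<close> to \<open>x \<otimes> h\<close>, at the price of replacing
      \<open>v\<close> by a vector of the same norm.\<close>
    define w where "w = \<sigma> (inv h) v"
    have w: "w \<in> carrier V" by (simp add: w_def A.sigma_carrier A.H_inv h v)
    have wn: "hnorm V w = hnorm V v" by (simp add: w_def A.sigma_hnorm A.H_inv h v)
    have "\<sigma> h w = v"
      using A.sigma_mult[OF h A.H_inv[OF h] v] hG v by (simp add: w_def A.sigma_one)
    then have "T v = B.\<pi> h (T w)" using T_sigma[OF h w] by simp
    then have "T v x = T w (x \<otimes> h)" using x w by (simp add: B.ind_rep_apply T_mem)
    also have "T w = T (\<Sum>e\<in>E. scaleC (cinner V w e) e)"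
      using A.V.orthonormal_expansion[OF E(2,1), of w] w E(3) by simp
    also have "\<dots> = (\<Sum>e\<in>E. T (scaleC (cinner V w e) e))"
      using sub by (intro T_sum A.V.scaleC_carrier) auto
    also have "\<dots> = (\<Sum>e\<in>E. scaleC (cinner V w e) (T e))"
      using sub by (intro sum.cong refl T_scaleC) auto
    also have "\<dots> (x \<otimes> h) = (\<Sum>e\<in>E. scaleC (cinner V w e) (T e (x \<otimes> h)))"
      by (induction E rule: infinite_finite_induct) (simp_all add: scaleC_fun_def)
    finally have Tv: "T v x = (\<Sum>e\<in>E. scaleC (cinner V w e) (T e (x \<otimes> h)))" .
    have TeW: "T e (x \<otimes> h) \<in> carrier W" if "e \<in> E" for e
      using TE[OF that] x hG by (intro B.I_value) auto
    have "c \<le> (\<Sum>e\<in>E. hnorm W (scaleC (cinner V w e) (T e (x \<otimes> h))))"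
      unfolding c_def Tv by (intro B.V.hnorm_sum B.V.scaleC_carrier TeW)
    also have "\<dots> \<le> (\<Sum>e\<in>E. hnorm V v * hnorm W (T e (x \<otimes> h)))"
    proof (intro sum_mono)
      fix e assume e: "e \<in> E"
      have "cmod (cinner V w e) \<le> hnorm V v"
        using A.V.cmod_cinner_le[OF w, of e] e sub en wn by auto
      then show "hnorm W (scaleC (cinner V w e) (T e (x \<otimes> h))) \<le> hnorm V v * hnorm W (T e (x \<otimes> h))"
        using TeW[OF e] by (simp add: B.V.hnorm_scaleC mult_right_mono B.V.hnorm_nonneg)
    qed
    finally show ?thesis .
  qed
  \<comment> \<open>If all \<open>T e\<close> stayed below \<open>d\<close> at
    \<open>x \<otimes> h\<close>, the sum in \<open>cle\<close> would be less than \<open>c\<close>.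
    The added ones keep the denominator positive and make that inequality strict.\<close>
  define d where "d = c / ((hnorm V v + 1) * (real (card E) + 1))"
  have vn: "0 \<le> hnorm V v" by (rule A.V.hnorm_nonneg[OF v])
  have d: "0 < d" using c vn by (simp add: d_def)
  define S where "S e = {C \<in> rcosets K. d\<^sup>2 \<le> (hnorm W (T e (coset_rep C)))\<^sup>2}" for e
  have "(\<lambda>h. K #> (x \<otimes> h)) ` H \<subseteq> (\<Union>e\<in>E. S e)"
  proof clarify
    fix h assume h: "h \<in> H"
    have xh: "x \<otimes> h \<in> carrier G" using x A.H_carrier[OF h] by simp
    have "\<exists>e\<in>E. d \<le> hnorm W (T e (x \<otimes> h))"
    proof (rule ccontr)
      assume "\<not> (\<exists>e\<in>E. d \<le> hnorm W (T e (x \<otimes> h)))"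
      then have "(\<Sum>e\<in>E. hnorm V v * hnorm W (T e (x \<otimes> h))) \<le> (\<Sum>e\<in>E. hnorm V v * d)"
        using vn by (intro sum_mono mult_left_mono) auto
      also have "\<dots> = (hnorm V v * real (card E)) * d" by simp
      also have "\<dots> < ((hnorm V v + 1) * (real (card E) + 1)) * d"
        using d vn by (intro mult_strict_right_mono) (simp_all add: algebra_simps add_pos_nonneg)
      also have "\<dots> = c" using vn by (simp add: d_def)
      finally show False using cle[OF h] by simp
    qed
    then obtain e where e: "e \<in> E" "d \<le> hnorm W (T e (x \<otimes> h))" by blast
    have "hnorm W (T e (coset_rep (K #> (x \<otimes> h)))) = hnorm W (T e (x \<otimes> h))"
      by (intro B.equivariant_hnorm B.I_equivariant TE e xh B.coset_rep_in_rcoset)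
    then have "K #> (x \<otimes> h) \<in> S e"
      using e d by (simp add: S_def B.rcosetI[OF xh] power_mono)
    then show "K #> (x \<otimes> h) \<in> (\<Union>e\<in>E. S e)" using e by blast
  qed
  moreover have "finite (S e)" if "e \<in> E" for e
    unfolding S_def using d
    by (intro finite_superlevel_if_summable_on B.I_summable TE that) simp_all
  ultimately show False using inf E(1) by (meson finite_UN finite_subset)
qed

end

subsection \<open>Irreducibility\<close>

lemma irreducible_repD:
  "\<lbrakk>irreducible_rep G V \<pi>; closed_subspace V S; \<And>g. g \<in> carrier G \<Longrightarrow> \<pi> g ` S \<subseteq> S\<rbrakk>
    \<Longrightarrow> S = {0} \<or> S = carrier V"
  by (simp add: irreducible_rep_def)

text \<open>The projection \<open>P\<close> onto \<open>W\<close> preserves the copy of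
  \<open>V\<close>, so the part \<open>S\<close> of the copy inside \<open>W\<close> decides
  everything. If \<open>S\<close> is zero, \<open>P\<close> kills the copy, so \<open>W\<close> is
  orthogonal to it and, being invariant, vanishes. If \<open>S\<close> is all of \<open>V\<close>,
  \<open>W\<close> contains every translate of the copy, and nothing nonzero is orthogonal to all of
  them.\<close>

theorem (in induced_rep) ind_rep_irreducible:
  assumes irr: "irreducible_rep (G\<lparr>carrier := H\<rparr>) V \<sigma>" and fd: "finite_dimensional V"
    and inf: "\<And>x. \<lbrakk>x \<in> carrier G; x \<notin> H\<rbrakk> \<Longrightarrow> infinite ((\<lambda>h. H #> (x \<otimes> h)) ` H)"
  shows "irreducible_rep G I \<pi>"
  unfolding irreducible_rep_def
proof (intro conjI allI impI)
  show "unitary_rep G I \<pi>" by (rule ind_rep_unitary_rep)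
  obtain v where v: "v \<in> carrier V" "v \<noteq> 0"
    using irr V.zero_carrier by (auto simp: irreducible_rep_def)
  then have "delta v \<noteq> 0" using delta_one[of v] by (metis zero_fun_apply)
  then show "carrier I \<noteq> {0}" using delta_mem[OF v(1)] by blast
  fix W assume W: "closed_subspace I W \<and> (\<forall>g\<in>carrier G. \<pi> g ` W \<subseteq> W)"
  have sW: "cvec.subspace W" using W by (simp add: closed_subspace_def)
  have WI: "f \<in> carrier I" if "f \<in> W" for f
    using W that closedin_subset by (fastforce simp: closed_subspace_def)
  have inv: "\<pi> g f \<in> W" if "g \<in> carrier G" "f \<in> W" for g f using W that by blast
  obtain P where P: "\<And>f. f \<in> carrier I \<Longrightarrow> P f \<in> W"
      and orth: "\<And>f y. \<lbrakk>f \<in> carrier I; y \<in> W\<rbrakk> \<Longrightarrow> cinner I (f - P f) y = 0"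
    using I.orthogonal_projection_exists[of W] W by metis
  note PI = WI[OF P]
  \<comment> \<open>Linearity of \<open>P\<close> and its commutation with the group all follow from
    this: the candidate lies in \<open>W\<close> and leaves a residual orthogonal to
    \<open>W\<close>.\<close>
  have P_unique: "P f = w"
    if f: "f \<in> carrier I" and w: "w \<in> W" and o: "\<And>y. y \<in> W \<Longrightarrow> cinner I (f - w) y = 0" for f w
  proof -
    have d: "P f - w \<in> W" by (intro cvec.subspace_diff[OF sW] P f w)
    have "P f - w = (f - w) - (f - P f)" by simp
    then have "cinner I (P f - w) (P f - w)
        = cinner I (f - w) (P f - w) - cinner I (f - P f) (P f - w)"
      using I.cinner_diff_left[of "f - w" "f - P f" "P f - w"] f w WI[OF w] PI[OF f] WI[OF d]
      by (simp add: I.diff_carrier)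
    then have "P f - w = 0"
      using o[OF d] orth[OF f d] I.eq_zero_if_cinner_self[OF WI[OF d]] by simp
    then show ?thesis by simp
  qed
  have P_add: "P (f + k) = P f + P k" if f: "f \<in> carrier I" and k: "k \<in> carrier I" for f k
  proof (rule P_unique)
    fix y assume y: "y \<in> W"
    have "f + k - (P f + P k) = (f - P f) + (k - P k)" by simp
    then show "cinner I (f + k - (P f + P k)) y = 0"
      using I.cinner_add_left[of "f - P f" "k - P k" y] orth[OF f y] orth[OF k y] f k y
      by (simp only: I.diff_carrier PI WI) simp
  qed (use f k in \<open>auto intro: I.add_carrier cvec.subspace_add[OF sW] P\<close>)
  have P_scaleC: "P (scaleC c f) = scaleC c (P f)" if f: "f \<in> carrier I" for c f
  proof (rule P_unique)
    fix y assume y: "y \<in> W"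
    have "scaleC c f - scaleC c (P f) = scaleC c (f - P f)"
      by (simp add: cvec.scale_right_diff_distrib)
    then show "cinner I (scaleC c f - scaleC c (P f)) y = 0"
      using I.cinner_scaleC_left[of "f - P f" y c] orth[OF f y] f y
      by (simp only: I.diff_carrier PI WI) simp
  qed (use f in \<open>auto intro: I.scaleC_carrier cvec.subspace_scale[OF sW] P\<close>)
  have P_pi: "P (\<pi> g f) = \<pi> g (P f)" if g: "g \<in> carrier G" and f: "f \<in> carrier I" for g f
  proof (rule P_unique)
    fix y assume y: "y \<in> W"
    \<comment> \<open>Unitarity removes \<open>\<pi> g\<close> from both arguments; invariance of
      \<open>W\<close> under \<open>inv g\<close> keeps the second argument in
      \<open>W\<close>.\<close>
    have "cinner I (\<pi> g f - \<pi> g (P f)) y = cinner I (\<pi> g (f - P f)) (\<pi> g (\<pi> (inv g) y))"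
      using g f y by (simp add: ind_rep_diff PI ind_rep_inv WI)
    also have "\<dots> = cinner I (f - P f) (\<pi> (inv g) y)"
      using g f y by (intro ind_rep_cinner) (auto intro: I.diff_carrier PI WI inv)
    also have "\<dots> = 0" using g y by (intro orth f inv) auto
    finally show "cinner I (\<pi> g f - \<pi> g (P f)) y = 0" .
  qed (use g f in \<open>auto intro: ind_rep_carrier inv P\<close>)
  interpret T: intertwiner G V H \<sigma> V H \<sigma> "\<lambda>v. P (delta v)"
    by unfold_locales
       (use fd in \<open>auto simp: PI delta_mem delta_add delta_scaleC P_add P_scaleC delta_sigma P_pi H_carrier\<close>)
  have P_delta: "P (delta v) = delta (P (delta v) \<one>)" if v: "v \<in> carrier V" for v
    by (rule eq_delta[OF PI[OF delta_mem[OF v]]]) (rule T.vanish_on_infinite_orbit[OF _ v inf])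
  define S where "S = {v \<in> carrier V. delta v \<in> W}"
  have "cvec.subspace S"
    using cvec.subspace_0[OF sW]
    by (auto simp: S_def cvec.subspace_def V.zero_carrier V.add_carrier V.scaleC_carrier delta_zero
        delta_add delta_scaleC cvec.subspace_add[OF sW] cvec.subspace_scale[OF sW])
  then have "closed_subspace V S"
    by (rule V.finite_dimensional_closed_subspace[OF fd]) (auto simp: S_def)
  moreover have "\<sigma> h ` S \<subseteq> S" if "h \<in> H" for h
    using that by (auto simp: S_def sigma_carrier delta_sigma inv H_carrier)
  ultimately have "S = {0} \<or> S = carrier V"
    by (intro irreducible_repD[OF irr]) simp_all
  then consider "S = {0}" | "S = carrier V" by blast
  then show "W = {0} \<or> W = carrier I"
  proof cases
    case 1
    have orth_delta: "cinner I f (delta v) = 0" if f: "f \<in> W" and v: "v \<in> carrier V" for f v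
    proof -
      have "P (delta v) \<one> \<in> S"
        using P_delta[OF v] P[OF delta_mem[OF v]] I_value[OF PI[OF delta_mem[OF v]]]
        by (simp add: S_def)
      then have "P (delta v) = 0" using 1 P_delta[OF v] by (simp add: delta_zero)
      then have "cinner I (delta v) f = 0" using orth[OF delta_mem[OF v] f] by simp
      then show ?thesis using I.cinner_commute[OF WI[OF f] delta_mem[OF v]] by simp
    qed
    have "f = 0" if f: "f \<in> W" for f
    proof
      fix x
      show "f x = 0 x"
      proof (cases "x \<in> carrier G")
        case True
        have fx: "f x \<in> carrier V" by (rule I_value[OF WI[OF f] True])
        have "cinner V (f x) (f x) = cinner I (\<pi> x f) (delta (f x))"
          using True fx f
          by (simp add: cinner_delta ind_rep_carrier WI ind_rep_apply)
        also have "\<dots> = 0" by (intro orth_delta inv True f fx)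
        finally show ?thesis using V.eq_zero_if_cinner_self[OF fx] by simp
      qed (simp add: equivariantD(1)[OF I_equivariant[OF WI[OF f]]])
    qed
    then show ?thesis using cvec.subspace_0[OF sW] by blast
  next
    case 2
    have "f \<in> W" if f: "f \<in> carrier I" for f
    proof -
      define u where "u = f - P f"
      have u: "u \<in> carrier I" unfolding u_def by (intro I.diff_carrier f PI)
      have "u = 0"
      proof
        fix x
        show "u x = 0 x"
        proof (cases "x \<in> carrier G")
          case True
          have ux: "u x \<in> carrier V" by (rule I_value[OF u True])
          then have "\<pi> (inv x) (delta (u x)) \<in> W" using 2 True by (auto simp: S_def intro: inv)
          then have "cinner V (u x) (u x) = 0"
            using cinner_translate_delta[OF u ux True] orth[OF f] by (simp add: u_def)
          then show ?thesis using V.eq_zero_if_cinner_self[OF ux] by simp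
        qed (simp add: equivariantD(1)[OF I_equivariant[OF u]])
      qed
      then show ?thesis using P[OF f] by (simp add: u_def)
    qed
    then show ?thesis using WI by blast
  qed
qed

subsection \<open>Equivalence\<close>

text \<open>The function \<open>U (f (inv c \<otimes> x))\<close> of \<open>x\<close> is
  \<open>K\<close>-equivariant because moving \<open>k \<in> K\<close> past \<open>inv c\<close>
  turns it into its conjugate in \<open>H\<close>. Left translation commutes with the right
  translations by which the group acts.\<close>

lemma conjugate_induced_equivalent:
  fixes G (structure)
  assumes "induced_rep G V H \<sigma>" and "induced_rep G W K \<tau>" and c: "c \<in> carrier G"
    and HK: "\<And>h. h \<in> H \<Longrightarrow> c \<otimes> h \<otimes> inv c \<in> K" and KH: "\<And>k. k \<in> K \<Longrightarrow> inv c \<otimes> k \<otimes> c \<in> H"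
    and eq: "equivalent_reps (G\<lparr>carrier := H\<rparr>) V \<sigma> W (conj_rep G c \<tau>)"
  shows "equivalent_reps G (ind_space G H V \<sigma>) (ind_rep G H V \<sigma>)
    (ind_space G K W \<tau>) (ind_rep G K W \<tau>)"
proof -
  interpret A: induced_rep G V H \<sigma> by fact
  interpret B: induced_rep G W K \<tau> by fact
  obtain U where U: "unitary_map V W U"
    and inter: "\<And>h v. \<lbrakk>h \<in> H; v \<in> carrier V\<rbrakk> \<Longrightarrow> U (\<sigma> h v) = \<tau> (c \<otimes> h \<otimes> inv c) (U v)"
    using eq by (auto simp: equivalent_reps_def conj_rep_def)
  have cancel: "c \<otimes> (inv c \<otimes> x) = x" "inv c \<otimes> (c \<otimes> x) = x" if "x \<in> carrier G" for x
    using that c by (simp_all add: A.m_assoc[symmetric])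
  have conj: "c \<otimes> (inv c \<otimes> k \<otimes> c) \<otimes> inv c = k" "inv c \<otimes> (c \<otimes> k \<otimes> inv c) \<otimes> c = k"
    if "k \<in> carrier G" for k
    using that c cancel by (simp_all add: A.m_assoc)
  interpret T: rep_transport G V H \<sigma> W K \<tau> "\<lambda>x. inv c \<otimes> x" "\<lambda>k. inv c \<otimes> k \<otimes> c" U
  proof
    show "unitary_map V W U" by (rule U)
    show "bij_betw (\<lambda>x. inv c \<otimes> x) (carrier G) (carrier G)"
      by (rule bij_betw_byWitness[where f' = "\<lambda>x. c \<otimes> x"]) (use c cancel in auto)
    show "bij_betw (\<lambda>k. inv c \<otimes> k \<otimes> c) K H"
      by (rule bij_betw_byWitness[where f' = "\<lambda>h. c \<otimes> h \<otimes> inv c"])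
         (use conj HK KH A.H_carrier B.H_carrier in auto)
    fix k assume k: "k \<in> K"
    show "inv c \<otimes> (k \<otimes> x) = (inv c \<otimes> k \<otimes> c) \<otimes> (inv c \<otimes> x)" if x: "x \<in> carrier G" for x
      using B.H_carrier[OF k] c x cancel by (simp add: A.m_assoc)
    show "U (\<sigma> (inv c \<otimes> k \<otimes> c) v) = \<tau> k (U v)" if v: "v \<in> carrier V" for v
      using inter[OF KH[OF k] v] conj(1)[OF B.H_carrier[OF k]] by simp
  qed
  have "transport G (\<lambda>x. inv c \<otimes> x) U (A.\<pi> g f) = B.\<pi> g (transport G (\<lambda>x. inv c \<otimes> x) U f)"
    if g: "g \<in> carrier G" and f: "f \<in> carrier A.I" for g f
  proof
    fix x
    show "transport G (\<lambda>x. inv c \<otimes> x) U (A.\<pi> g f) x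
        = B.\<pi> g (transport G (\<lambda>x. inv c \<otimes> x) U f) x"
      using T.transport_mem[OF f] g f c
      by (cases "x \<in> carrier G")
         (simp_all add: B.ind_rep_apply A.ind_rep_apply transport_def A.m_assoc ind_rep_def)
  qed
  then show ?thesis
    unfolding equivalent_reps_def using T.transport_unitary by blast
qed

context intertwiner
begin

context
  assumes iso: "\<And>v w. \<lbrakk>v \<in> carrier V; w \<in> carrier V\<rbrakk> \<Longrightarrow> cinner B.I (T v) (T w) = cinner V v w"
    and nonzero: "carrier V \<noteq> {0}"
begin

text \<open>Otherwise \<open>T\<close> would vanish identically, against being isometric on a
  nonzero space.\<close>

lemma not_all_orbits_infinite:
  assumes inf: "\<And>x. x \<in> carrier G \<Longrightarrow> infinite ((\<lambda>h. K #> (x \<otimes> h)) ` H)"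
  shows False
proof -
  have "v = 0" if v: "v \<in> carrier V" for v
  proof -
    have "T v x = 0" for x
      using vanish_on_infinite_orbit[OF _ v inf, of x]
        B.equivariantD(1)[OF B.I_equivariant[OF T_mem[OF v]], of x] by blast
    then have "T v = 0" by auto
    then show ?thesis
      using iso[OF v v] A.V.eq_zero_if_cinner_self[OF v] B.I.cinner_zero_left[OF B.I_zero] by simp
  qed
  then show False using nonzero A.V.zero_carrier by blast
qed

text \<open>Every \<open>T v\<close> is supported on the coset \<open>K #> c\<close>, so evaluation
  at \<open>c\<close> keeps all of its norm and \<open>U\<close> is isometric. Its image is a
  nonzero invariant subspace of \<open>W\<close>, hence everything by irreducibility of
  \<tau>.\<close>

lemma equivalent_conjugate:
  assumes c: "c \<in> carrier G"
    and HK: "\<And>h. h \<in> H \<Longrightarrow> c \<otimes> h \<otimes> inv c \<in> K" and KH: "\<And>k. k \<in> K \<Longrightarrow> inv c \<otimes> k \<otimes> c \<in> H"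
    and inf: "\<And>x. \<lbrakk>x \<in> carrier G; x \<notin> K #> c\<rbrakk> \<Longrightarrow> infinite ((\<lambda>h. K #> (x \<otimes> h)) ` H)"
    and irr: "irreducible_rep (G\<lparr>carrier := K\<rparr>) W \<tau>" and fdW: "finite_dimensional W"
  shows "equivalent_reps (G\<lparr>carrier := H\<rparr>) V \<sigma> W (conj_rep G c \<tau>)"
proof -
  define U where "U v = T v c" for v
  have UW: "U v \<in> carrier W" if "v \<in> carrier V" for v
    unfolding U_def by (intro B.I_value T_mem that c)
  have U_iso: "cinner W (U v) (U w) = cinner V v w" if v: "v \<in> carrier V" and w: "w \<in> carrier V" for v w
    using B.cinner_I_single[OF T_mem[OF v] T_mem[OF w] c] vanish_on_infinite_orbit[OF _ w inf]
      iso[OF v w] by (simp add: U_def)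
  have U_add: "U (v + w) = U v + U w" if "v \<in> carrier V" "w \<in> carrier V" for v w
    using that by (simp add: U_def T_add)
  have U_scaleC: "U (scaleC a v) = scaleC a (U v)" if "v \<in> carrier V" for a v
    using that by (simp add: U_def T_scaleC scaleC_fun_def)
  have U_zero: "U 0 = 0" by (simp add: U_def T_zero)
  have inj: "inj_on U (carrier V)"
  proof
    fix v w assume v: "v \<in> carrier V" and w: "w \<in> carrier V" and eq: "U v = U w"
    have d: "v - w \<in> carrier V" by (intro A.V.diff_carrier v w)
    have "U (v - w) = 0" using U_add[OF d w] eq by simp
    then have "cinner V (v - w) (v - w) = 0"
      using U_iso[OF d d] B.V.cinner_zero_left[OF B.V.zero_carrier] by simp
    then show "v = w" using A.V.eq_zero_if_cinner_self[OF d] by simp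
  qed
  have U_sigma: "U (\<sigma> h v) = \<tau> (c \<otimes> h \<otimes> inv c) (U v)" if h: "h \<in> H" and v: "v \<in> carrier V" for h v
  proof -
    have hG: "h \<in> carrier G" by (rule A.H_carrier[OF h])
    have "U (\<sigma> h v) = T v (c \<otimes> h)"
      using c by (simp add: U_def T_sigma h v B.ind_rep_apply T_mem)
    \<comment> \<open>The right translation by \<open>h\<close> becomes a left multiplication by an
      element of \<open>K\<close>, to which equivariance applies.\<close>
    also have "c \<otimes> h = (c \<otimes> h \<otimes> inv c) \<otimes> c" using c hG by (simp add: A.m_assoc)
    also have "T v \<dots> = \<tau> (c \<otimes> h \<otimes> inv c) (U v)"
      unfolding U_def by (rule B.equivariantD(3)[OF B.I_equivariant[OF T_mem[OF v]] HK[OF h] c])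
    finally show ?thesis .
  qed
  have "cvec.subspace (U ` carrier V)"
    unfolding cvec.subspace_def
    using U_zero[symmetric] U_add[symmetric] U_scaleC[symmetric]
    by (auto intro!: imageI simp: A.V.zero_carrier A.V.add_carrier A.V.scaleC_carrier)
  then have "closed_subspace W (U ` carrier V)"
    by (rule B.V.finite_dimensional_closed_subspace[OF fdW]) (use UW in auto)
  moreover have "\<tau> k ` (U ` carrier V) \<subseteq> U ` carrier V" if k: "k \<in> K" for k
  proof (intro image_subsetI)
    fix w assume "w \<in> U ` carrier V"
    then obtain v where v: "v \<in> carrier V" "w = U v" by blast
    have kG: "k \<in> carrier G" by (rule B.H_carrier[OF k])
    have "c \<otimes> (inv c \<otimes> (k \<otimes> (c \<otimes> inv c))) = k"
      using c kG A.inv_solve_left[of c k] by (simp add: A.m_assoc[symmetric])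
    then have "c \<otimes> (inv c \<otimes> k \<otimes> c) \<otimes> inv c = k"
      using c kG by (simp add: A.m_assoc)
    then have "\<tau> k w = U (\<sigma> (inv c \<otimes> k \<otimes> c) v)" using U_sigma[OF KH[OF k] v(1)] v by simp
    then show "\<tau> k w \<in> U ` carrier V" using v KH[OF k] by (simp add: A.sigma_carrier)
  qed
  ultimately have "U ` carrier V = {0} \<or> U ` carrier V = carrier W"
    by (intro irreducible_repD[OF irr]) simp_all
  then consider "U ` carrier V = {0}" | "U ` carrier V = carrier W" by (elim disjE)
  then have "U ` carrier V = carrier W"
  proof cases
    case 1
    have "v = 0" if v: "v \<in> carrier V" for v
    proof -
      have "U v = U 0" using 1 v U_zero by auto
      then show ?thesis using inj_onD[OF inj _ v A.V.zero_carrier] by blast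
    qed
    then show ?thesis using nonzero A.V.zero_carrier by blast
  qed
  then have "unitary_map V W U"
    using inj by (simp add: unitary_map_def bij_betw_def U_add U_scaleC U_iso)
  then show ?thesis
    unfolding equivalent_reps_def using U_sigma by (auto simp: conj_rep_def)
qed

end

end

text \<open>Restricting the equivalence to the copy of \<open>V\<close> suffices, since
  \<open>delta\<close> is itself an isometric \<open>H\<close>-intertwiner.\<close>

lemma intertwiner_of_equivalence:
  fixes G (structure)
  assumes "induced_rep G V H \<sigma>" and "induced_rep G W K \<tau>" and fd: "finite_dimensional V"
    and eq: "equivalent_reps G (ind_space G H V \<sigma>) (ind_rep G H V \<sigma>)
      (ind_space G K W \<tau>) (ind_rep G K W \<tau>)"
  obtains T where "intertwiner G V H \<sigma> W K \<tau> T"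
    and "\<And>v w. \<lbrakk>v \<in> carrier V; w \<in> carrier V\<rbrakk>
      \<Longrightarrow> cinner (ind_space G K W \<tau>) (T v) (T w) = cinner V v w"
proof -
  interpret A: induced_rep G V H \<sigma> by fact
  interpret B: induced_rep G W K \<tau> by fact
  obtain \<Phi> where \<Phi>: "unitary_map A.I B.I \<Phi>"
    and inter: "\<And>g f. \<lbrakk>g \<in> carrier G; f \<in> carrier A.I\<rbrakk> \<Longrightarrow> \<Phi> (A.\<pi> g f) = B.\<pi> g (\<Phi> f)"
    using eq by (auto simp: equivalent_reps_def)
  note \<Phi>D = unitary_mapD[OF \<Phi>]
  show thesis
  proof
    show "intertwiner G V H \<sigma> W K \<tau> (\<lambda>v. \<Phi> (A.delta v))"
      by unfold_locales
         (use fd in \<open>simp_all add: \<Phi>D(2-4) A.delta_mem A.delta_add A.delta_scaleC A.delta_sigma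
            inter A.H_carrier\<close>)
    show "cinner B.I (\<Phi> (A.delta v)) (\<Phi> (A.delta w)) = cinner V v w"
      if "v \<in> carrier V" "w \<in> carrier V" for v w
      using that by (simp add: \<Phi>D(5) A.delta_mem A.cinner_delta A.delta_one)
  qed
qed

section \<open>Thompson's group\<close>

abbreviation unit_interval :: "real set" where "unit_interval \<equiv> {0..1}"

definition dyadic_piecewise :: "real set \<Rightarrow> (real \<Rightarrow> real) \<Rightarrow> bool" where
  "dyadic_piecewise S f \<longleftrightarrow> finite S \<and> S \<subseteq> dyadics \<and>
     (\<forall>u v. 0 \<le> u \<longrightarrow> u < v \<longrightarrow> v \<le> 1 \<longrightarrow> S \<inter> {u<..<v} = {} \<longrightarrow>
       (\<exists>(k::int) c. \<forall>x\<in>{u..v}. f x = 2 powi k * x + c))"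

definition thompson_map :: "(real \<Rightarrow> real) \<Rightarrow> bool" where
  "thompson_map f \<longleftrightarrow> f \<in> Bij unit_interval \<and> strict_mono_on unit_interval f \<and>
     f ` (dyadics \<inter> unit_interval) = dyadics \<inter> unit_interval \<and> (\<exists>S. dyadic_piecewise S f)"

text \<open>\<open>t\<close> may be an end point of the interval: a one-sided derivative on a
  nondegenerate interval already determines the slope. This allows the pieces on both sides of a
  point to be compared.\<close>

lemma affine_derivative_unique:
  fixes f :: "real \<Rightarrow> real"
  assumes uv: "0 \<le> u" "u < v" "v \<le> 1" and t: "t \<in> {u..v}"
    and f: "\<And>x. x \<in> {u..v} \<Longrightarrow> f x = m * x + c"
    and D: "(f has_real_derivative D) (at t within unit_interval)"
  shows "D = m"
proof -
  have 1: "(f has_vector_derivative D) (at t within cbox u v)"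
    using DERIV_subset[OF D, of "{u..v}"] uv
    by (simp add: has_real_derivative_iff_has_vector_derivative)
  have "((\<lambda>x. m * x + c) has_real_derivative m) (at t within {u..v})"
    by (auto intro!: derivative_eq_intros)
  then have "(f has_real_derivative m) (at t within {u..v})"
    by (rule has_field_derivative_transform_within[OF _ zero_less_one t]) (use f in auto)
  then have 2: "(f has_vector_derivative m) (at t within cbox u v)"
    by (simp add: has_real_derivative_iff_has_vector_derivative)
  show ?thesis
    by (rule vector_derivative_unique_within_closed_interval[OF _ _ 1 2]) (use uv t in auto)
qed

text \<open>At a point of \<open>S\<close> where \<open>f\<close> is differentiable, the slopes on
  both sides equal the derivative, so the two affine pieces are one. The induction removes such
  points from the interior.\<close>

lemma piecewise_linear_differentiable_affine:
  assumes S: "finite S"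
    and pl: "\<And>u v. \<lbrakk>0 \<le> u; u < v; v \<le> 1; S \<inter> {u<..<v} = {}\<rbrakk>
        \<Longrightarrow> \<exists>m c. \<forall>x\<in>{u..v}. f x = m * x + c"
    and uv: "0 \<le> u" "u < v" "v \<le> 1"
    and df: "\<And>t. t \<in> {u<..<v} \<Longrightarrow> f differentiable (at t within unit_interval)"
  shows "\<exists>m c. \<forall>x\<in>{u..v}. f x = m * x + (c::real)"
  using uv df
proof (induction "card (S \<inter> {u<..<v})" arbitrary: u v rule: less_induct)
  case less
  show ?case
  proof (cases "S \<inter> {u<..<v} = {}")
    case True
    then show ?thesis using pl less by simp
  next
    case False
    then obtain s where s: "s \<in> S" "u < s" "s < v" by auto
    have "\<exists>m c. \<forall>x\<in>{u..s}. f x = m * x + c"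
      by (rule less(1)) (use s less S in \<open>auto intro!: psubset_card_mono\<close>)
    then obtain m c where mc: "\<And>x. x \<in> {u..s} \<Longrightarrow> f x = m * x + c" by blast
    have "\<exists>m c. \<forall>x\<in>{s..v}. f x = m * x + c"
      by (rule less(1)) (use s less S in \<open>auto intro!: psubset_card_mono\<close>)
    then obtain m' c' where mc': "\<And>x. x \<in> {s..v} \<Longrightarrow> f x = m' * x + c'" by blast
    obtain D where D: "(f has_real_derivative D) (at s within unit_interval)"
      using less(5)[of s] s by (auto simp: real_differentiable_def)
    have "D = m" by (rule affine_derivative_unique[OF _ _ _ _ mc D]) (use s less in auto)
    moreover have "D = m'" by (rule affine_derivative_unique[OF _ _ _ _ mc' D]) (use s less in auto)
    ultimately have "m' = m" "c' = c" using mc[of s] mc'[of s] s by auto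
    then have "f x = m * x + c" if "x \<in> {u..v}" for x
      using that mc[of x] mc'[of x] by (cases "x \<le> s") auto
    then show ?thesis by blast
  qed
qed

text \<open>A monotone map with open image is continuous. The unit interval is not open, so
  \<open>f\<close> is extended by the identity to a monotone surjection of the line.\<close>

lemma strict_mono_on_bij_continuous:
  assumes bij: "bij_betw f unit_interval unit_interval" and mono: "strict_mono_on unit_interval f"
  shows "continuous_on unit_interval f"
proof -
  define F where "F x = (if x \<in> unit_interval then f x else x)" for x
  have fI: "f x \<in> unit_interval" if "x \<in> unit_interval" for x
    using bij that by (rule bij_betw_apply)
  have "continuous_on UNIV F"
  proof (rule continuous_onI_mono)
    have "y \<in> range F" for y
    proof (cases "y \<in> unit_interval")
      case True
      then obtain x where "x \<in> unit_interval" "f x = y"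
        using bij_betw_imp_surj_on[OF bij] by (metis imageE)
      then show ?thesis by (metis F_def rangeI)
    next
      case False
      then show ?thesis by (metis F_def rangeI)
    qed
    then have "range F = UNIV" by auto
    then show "open (F ` UNIV)" by simp
    show "F x \<le> F y" if "x \<le> y" for x y
      using that fI[of x] fI[of y] mono by (auto simp: F_def strict_mono_on_leD)
  qed
  then have "continuous_on unit_interval F" by (rule continuous_on_subset) simp
  then show ?thesis by (rule continuous_on_eq) (simp add: F_def)
qed

lemma inv_into_strict_mono_on:
  assumes bij: "bij_betw f unit_interval unit_interval" and mono: "strict_mono_on unit_interval f"
  shows "strict_mono_on unit_interval (inv_into unit_interval f)"
proof (rule strict_mono_onI)
  fix x y :: real assume x: "x \<in> unit_interval" and y: "y \<in> unit_interval" and xy: "x < y"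
  let ?g = "inv_into unit_interval f"
  have g: "?g x \<in> unit_interval" "?g y \<in> unit_interval" "f (?g x) = x" "f (?g y) = y"
    using bij x y by (auto simp: bij_betw_def inv_into_into f_inv_into_f simp del: atLeastAtMost_iff)
  then have "\<not> ?g y \<le> ?g x" using xy strict_mono_on_leD[OF mono, of "?g y" "?g x"] by linarith
  then show "?g x < ?g y" by simp
qed

lemma strict_mono_on_bij_homeomorphism:
  assumes bij: "bij_betw f unit_interval unit_interval" and mono: "strict_mono_on unit_interval f"
  shows "homeomorphism unit_interval unit_interval f (inv_into unit_interval f)"
  using strict_mono_on_bij_continuous[OF assms] bij
    strict_mono_on_bij_continuous[OF bij_betw_inv_into[OF bij] inv_into_strict_mono_on[OF assms]]
    bij_betw_imp_surj_on[OF bij_betw_inv_into[OF bij]]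
  by (simp add: homeomorphism_def bij_betw_def f_inv_into_f del: atLeastAtMost_iff)

text \<open>The set provided by \<open>piecewise_linear\<close> may contain arbitrary reals. The
  points of nondifferentiability are known to be dyadic, and no other break can occur.\<close>

lemma dyadic_piecewise_if_thompson_F:
  assumes f: "f \<in> carrier thompson_F"
  shows "dyadic_piecewise {t \<in> unit_interval. \<not> f differentiable (at t within unit_interval)} f"
    (is "dyadic_piecewise ?N f")
  unfolding dyadic_piecewise_def
proof (intro conjI allI impI)
  show "finite ?N" "?N \<subseteq> dyadics" using f by (auto simp: thompson_F_def)
  fix u v :: real assume uv: "0 \<le> u" "u < v" "v \<le> 1" and N: "?N \<inter> {u<..<v} = {}"
  have df: "f differentiable (at t within unit_interval)" if "t \<in> {u<..<v}" for t
  proof -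
    have "t \<in> unit_interval" using that uv by auto
    then show ?thesis using N that by blast
  qed
  obtain S where "finite S" "\<And>u v. \<lbrakk>0 \<le> u; u < v; v \<le> 1; S \<inter> {u<..<v} = {}\<rbrakk>
        \<Longrightarrow> \<exists>m c. \<forall>x\<in>{u..v}. f x = m * x + c"
    using f by (auto simp: thompson_F_def piecewise_linear_def)
  then obtain m c where mc: "\<And>x. x \<in> {u..v} \<Longrightarrow> f x = m * x + c"
    using piecewise_linear_differentiable_affine[OF _ _ uv df] by metis
  \<comment> \<open>The slope of the affine piece is read off at an interior point, where it is a
    power of 2 by the definition of F.\<close>
  obtain D where D: "(f has_real_derivative D) (at ((u + v) / 2) within unit_interval)"
    using df[of "(u + v) / 2"] uv by (auto simp: real_differentiable_def)
  then have "D = m" by (intro affine_derivative_unique[OF uv _ mc]) (use uv in auto)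
  moreover obtain k :: int where "D = 2 powi k"
    using f D uv by (force simp: thompson_F_def)
  ultimately show "\<exists>(k::int) c. \<forall>x\<in>{u..v}. f x = 2 powi k * x + c" using mc by blast
qed

text \<open>Finiteness of \<open>S\<close> leaves a gap to the right of \<open>t\<close>, also when
  \<open>t\<close> itself is a break point.\<close>

lemma dyadic_piecewise_right:
  assumes S: "dyadic_piecewise S f" and t: "0 \<le> t" "t < 1"
  obtains v c :: real and k :: int where "t < v" "v \<le> 1" "\<And>x. x \<in> {t..v} \<Longrightarrow> f x = 2 powi k * x + c"
proof -
  obtain d where d: "d > 0" "\<forall>x\<in>S. x \<noteq> t \<longrightarrow> d \<le> dist t x"
    using finite_set_avoid[of S t] S by (auto simp: dyadic_piecewise_def)
  have "S \<inter> {t<..<min 1 (t + d)} = {}" using d by (force simp: dist_real_def)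
  moreover have "0 \<le> t" "t < min 1 (t + d)" "min 1 (t + d) \<le> 1" using t d by auto
  ultimately have "\<exists>(k::int) c. \<forall>x\<in>{t..min 1 (t + d)}. f x = 2 powi k * x + c"
    using S unfolding dyadic_piecewise_def by blast
  then show thesis using \<open>0 \<le> t\<close> \<open>t < min 1 (t + d)\<close> \<open>min 1 (t + d) \<le> 1\<close> that by blast
qed

lemma dyadic_piecewise_left:
  assumes S: "dyadic_piecewise S f" and t: "0 < t" "t \<le> 1"
  obtains u c :: real and k :: int where "u < t" "0 \<le> u" "\<And>x. x \<in> {u..t} \<Longrightarrow> f x = 2 powi k * x + c"
proof -
  obtain d where d: "d > 0" "\<forall>x\<in>S. x \<noteq> t \<longrightarrow> d \<le> dist t x"
    using finite_set_avoid[of S t] S by (auto simp: dyadic_piecewise_def)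
  have "S \<inter> {max 0 (t - d)<..<t} = {}" using d by (force simp: dist_real_def)
  moreover have "0 \<le> max 0 (t - d)" "max 0 (t - d) < t" "t \<le> 1" using t d by auto
  ultimately have "\<exists>(k::int) c. \<forall>x\<in>{max 0 (t - d)..t}. f x = 2 powi k * x + c"
    using S unfolding dyadic_piecewise_def by blast
  then show thesis using \<open>0 \<le> max 0 (t - d)\<close> \<open>max 0 (t - d) < t\<close> \<open>t \<le> 1\<close> that by blast
qed

lemma dyadic_piecewise_differentiable:
  assumes S: "dyadic_piecewise S f" and t: "t \<in> unit_interval" "t \<notin> S"
  shows "f differentiable (at t within unit_interval)"
proof -
  obtain d where d: "d > 0" "\<forall>x\<in>S. x \<noteq> t \<longrightarrow> d \<le> dist t x"
    using finite_set_avoid[of S t] S by (auto simp: dyadic_piecewise_def)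
  define u where "u = max 0 (t - d)"
  define v where "v = min 1 (t + d)"
  have uv: "0 \<le> u" "u < v" "v \<le> 1" "t \<in> {u..v}" using d t by (auto simp: u_def v_def)
  have "S \<inter> {u<..<v} = {}"
    using d t by (force simp: dist_real_def u_def v_def)
  then obtain k :: int and c where kc: "\<forall>x\<in>{u..v}. f x = 2 powi k * x + c"
    using S uv unfolding dyadic_piecewise_def by metis
  have "((\<lambda>x. 2 powi k * x + c) has_real_derivative 2 powi k) (at t within {u..v})"
    by (auto intro!: derivative_eq_intros)
  then have "(f has_real_derivative 2 powi k) (at t within {u..v})"
    by (rule has_field_derivative_transform_within[OF _ zero_less_one uv(4)]) (use kc in auto)
  also have "at t within {u..v} = at t within unit_interval"
    \<comment> \<open>Near \<open>t\<close> the two sets coincide, even if \<open>t\<close> is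
      \<open>0\<close> or \<open>1\<close>, because \<open>u\<close> and \<open>v\<close> are cut
      off only at the ends of the unit interval.\<close>
    by (rule at_within_nhd[of _ "{t - d<..<t + d}"]) (use d in \<open>auto simp: u_def v_def\<close>)
  finally show ?thesis by (auto simp: real_differentiable_def)
qed

text \<open>For the converse, nondifferentiability can occur only inside the break set, and a
  derivative equals the slope of an adjacent piece: the one on the right, or at \<open>1\<close> the
  one on the left.\<close>

lemma thompson_F_iff: "f \<in> carrier thompson_F \<longleftrightarrow> thompson_map f"
proof
  assume f: "f \<in> carrier thompson_F"
  then show "thompson_map f"
    using dyadic_piecewise_if_thompson_F[OF f] by (auto simp: thompson_F_def thompson_map_def)
next
  assume f: "thompson_map f"
  then obtain S where S: "dyadic_piecewise S f" by (auto simp: thompson_map_def)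
  have bij: "bij_betw f unit_interval unit_interval" and mono: "strict_mono_on unit_interval f"
    using f by (auto simp: thompson_map_def Bij_def)
  have sub: "{t \<in> unit_interval. \<not> f differentiable (at t within unit_interval)} \<subseteq> S"
    using dyadic_piecewise_differentiable[OF S] by blast
  have deriv: "\<exists>k::int. m = 2 powi k"
    if t: "t \<in> unit_interval" and m: "(f has_real_derivative m) (at t within unit_interval)" for t m
  proof (cases "t < 1")
    case True
    then obtain v c and k :: int where v: "t < v" "v \<le> 1" "\<And>x. x \<in> {t..v} \<Longrightarrow> f x = 2 powi k * x + c"
      using dyadic_piecewise_right[OF S] t by (metis atLeastAtMost_iff)
    have "m = 2 powi k" by (rule affine_derivative_unique[OF _ v(1,2) _ v(3) m]) (use t v in auto)
    then show ?thesis by blast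
  next
    case False
    then obtain u c and k :: int where u: "u < t" "0 \<le> u" "\<And>x. x \<in> {u..t} \<Longrightarrow> f x = 2 powi k * x + c"
      using dyadic_piecewise_left[OF S, of t] t by (metis atLeastAtMost_iff leI less_le_trans zero_less_one)
    have "m = 2 powi k" by (rule affine_derivative_unique[OF u(2,1) _ _ u(3) m]) (use t u in auto)
    then show ?thesis by blast
  qed
  have "piecewise_linear f"
    using S unfolding piecewise_linear_def dyadic_piecewise_def by metis
  then show "f \<in> carrier thompson_F"
    using f S sub deriv strict_mono_on_bij_homeomorphism[OF bij mono]
    by (auto simp: thompson_F_def thompson_map_def dyadic_piecewise_def intro: finite_subset)
qed

section \<open>Closure under composition and inversion\<close>

lemma thompson_map_carrier:
  assumes "thompson_map f"
  shows "bij_betw f unit_interval unit_interval" and "strict_mono_on unit_interval f"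
    and "f \<in> extensional unit_interval"
    and "x \<in> unit_interval \<Longrightarrow> f x \<in> unit_interval"
  using assms by (auto simp: thompson_map_def Bij_def simp del: atLeastAtMost_iff dest: bij_betw_apply)

lemma thompson_map_dyadic_iff:
  assumes "thompson_map f" and x: "x \<in> unit_interval"
  shows "f x \<in> dyadics \<longleftrightarrow> x \<in> dyadics"
proof
  assume "f x \<in> dyadics"
  then have "f x \<in> f ` (dyadics \<inter> unit_interval)"
    using thompson_map_carrier(4)[OF assms] assms by (simp add: thompson_map_def)
  then show "x \<in> dyadics"
    using x thompson_map_carrier(1)[OF assms(1)] by (auto simp: bij_betw_def dest!: inj_onD simp del: atLeastAtMost_iff)
next
  assume "x \<in> dyadics"
  then show "f x \<in> dyadics" using assms by (auto simp: thompson_map_def)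
qed

lemma thompson_map_id: "thompson_map (\<lambda>x\<in>unit_interval. x)"
proof -
  have "dyadic_piecewise {} (\<lambda>x\<in>unit_interval. x)"
    unfolding dyadic_piecewise_def by (auto intro!: exI[of _ "0::int"] exI[of _ "0::real"])
  then show ?thesis
    by (auto simp: thompson_map_def id_Bij strict_mono_on_def)
qed

text \<open>A break of the composite is a break of \<open>f\<close> or a preimage under
  \<open>f\<close> of a break of \<open>g\<close>. Such preimages are dyadic because
  \<open>f\<close> also reflects dyadicity, and slopes multiply.\<close>

lemma thompson_map_compose:
  assumes f: "thompson_map f" and g: "thompson_map g"
  shows "thompson_map (compose unit_interval g f)"
proof -
  note fD = thompson_map_carrier[OF f] and gD = thompson_map_carrier[OF g]
  obtain S T where S: "dyadic_piecewise S f" and T: "dyadic_piecewise T g"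
    using f g by (auto simp: thompson_map_def)
  have inj: "inj_on f unit_interval" using fD(1) by (simp add: bij_betw_def)
  define R where "R = S \<union> {x \<in> unit_interval. f x \<in> T}"
  have "finite {x \<in> unit_interval. f x \<in> T}"
  proof -
    have "finite (f -` T \<inter> unit_interval)"
      by (rule finite_vimage_IntI[OF _ inj]) (use T in \<open>simp add: dyadic_piecewise_def\<close>)
    then show ?thesis by (rule rev_finite_subset) auto
  qed
  then have R: "finite R" "R \<subseteq> dyadics"
    using S T thompson_map_dyadic_iff[OF f] by (auto simp: R_def dyadic_piecewise_def)
  have "dyadic_piecewise R (compose unit_interval g f)"
    unfolding dyadic_piecewise_def
  proof (intro conjI R allI impI)
    fix u v :: real assume uv: "0 \<le> u" "u < v" "v \<le> 1" and e: "R \<inter> {u<..<v} = {}"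
    have uvI: "x \<in> unit_interval" if "x \<in> {u..v}" for x using that uv by auto
    have "S \<inter> {u<..<v} = {}" using e by (auto simp: R_def)
    then obtain k :: int and c where kc: "\<forall>x\<in>{u..v}. f x = 2 powi k * x + c"
      using S uv unfolding dyadic_piecewise_def by blast
    have fuv: "f u < f v" using uv fD(2) by (simp add: strict_mono_on_def)
    have "f u \<in> unit_interval" "f v \<in> unit_interval"
      using uv by (intro fD(4) uvI; simp)+
    moreover have "T \<inter> {f u<..<f v} = {}"
    proof (rule ccontr)
      assume "T \<inter> {f u<..<f v} \<noteq> {}"
      then obtain y where y: "y \<in> T" "f u < y" "y < f v" by auto
      then have "y \<in> unit_interval" using \<open>f u \<in> unit_interval\<close> \<open>f v \<in> unit_interval\<close> by auto
      then obtain x where x: "x \<in> unit_interval" "f x = y"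
        using bij_betw_imp_surj_on[OF fD(1)] by (metis imageE)
      have "u < x" "x < v"
        using x y uv strict_mono_on_less[OF fD(2)] by auto
      then show False using e x y by (auto simp: R_def)
    qed
    ultimately obtain l :: int and d where ld: "\<forall>y\<in>{f u..f v}. g y = 2 powi l * y + d"
      using T fuv unfolding dyadic_piecewise_def atLeastAtMost_iff by blast
    have "compose unit_interval g f x = 2 powi (l + k) * x + (2 powi l * c + d)" if x: "x \<in> {u..v}" for x
    proof -
      have "f x \<in> {f u..f v}"
        using x uv strict_mono_on_leD[OF fD(2)] by auto
      then have "g (f x) = 2 powi l * (2 powi k * x + c) + d" using ld kc x by simp
      then show ?thesis using uvI[OF x] by (simp add: compose_def power_int_add algebra_simps)
    qed
    then show "\<exists>(k::int) c. \<forall>x\<in>{u..v}. compose unit_interval g f x = 2 powi k * x + c" by blast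
  qed
  moreover have "compose unit_interval g f ` (dyadics \<inter> unit_interval) = g ` f ` (dyadics \<inter> unit_interval)"
    by (auto simp: compose_def image_image intro!: image_cong)
  moreover have "strict_mono_on unit_interval (compose unit_interval g f)"
    using fD gD by (auto simp: compose_def strict_mono_on_def simp del: atLeastAtMost_iff)
  ultimately show ?thesis
    using f g by (auto simp: thompson_map_def compose_Bij)
qed

text \<open>The breaks of the inverse are the images of those of \<open>f\<close>, and the exponents
  of the slopes change sign.\<close>

lemma thompson_map_inverse:
  assumes f: "thompson_map f"
  shows "thompson_map (\<lambda>x\<in>unit_interval. inv_into unit_interval f x)" (is "thompson_map ?g")
proof -
  note fD = thompson_map_carrier[OF f]
  obtain S where S: "dyadic_piecewise S f" using f by (auto simp: thompson_map_def)
  have g: "?g y \<in> unit_interval" "f (?g y) = y" if "y \<in> unit_interval" for y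
    using fD(1) that by (auto simp: bij_betw_def inv_into_into f_inv_into_f simp del: atLeastAtMost_iff)
  have gf: "?g (f x) = x" if "x \<in> unit_interval" for x
    using fD(1,4) that by (auto simp: bij_betw_def simp del: atLeastAtMost_iff)
  define R where "R = f ` (S \<inter> unit_interval)"
  have R: "finite R" "R \<subseteq> dyadics"
    using S thompson_map_dyadic_iff[OF f] by (auto simp: R_def dyadic_piecewise_def)
  have mono: "strict_mono_on unit_interval ?g"
    using inv_into_strict_mono_on[OF fD(1,2)] by (auto simp: strict_mono_on_def)
  have "dyadic_piecewise R ?g"
    unfolding dyadic_piecewise_def
  proof (intro conjI R allI impI)
    fix u v :: real assume uv: "0 \<le> u" "u < v" "v \<le> 1" and e: "R \<inter> {u<..<v} = {}"
    have uI: "u \<in> unit_interval" and vI: "v \<in> unit_interval" using uv by auto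
    have "?g u < ?g v" using mono uI vI uv by (auto simp: strict_mono_on_def)
    moreover have "S \<inter> {?g u<..<?g v} = {}"
    proof (rule ccontr)
      assume "S \<inter> {?g u<..<?g v} \<noteq> {}"
      then obtain x where x: "x \<in> S" "?g u < x" "x < ?g v" by auto
      then have xI: "x \<in> unit_interval" using g(1)[OF uI] g(1)[OF vI] by auto
      have "u < f x" "f x < v"
        using strict_mono_onD[OF fD(2) g(1)[OF uI] xI x(2)]
          strict_mono_onD[OF fD(2) xI g(1)[OF vI] x(3)] g(2)[OF uI] g(2)[OF vI] by simp_all
      moreover have "f x \<in> R" using x xI by (simp add: R_def)
      ultimately show False using e by auto
    qed
    ultimately obtain k :: int and c where kc: "\<forall>x\<in>{?g u..?g v}. f x = 2 powi k * x + c"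
      using S g(1)[OF uI] g(1)[OF vI] unfolding dyadic_piecewise_def atLeastAtMost_iff by blast
    have "?g y = 2 powi (- k) * y + (- (2 powi (- k) * c))" if y: "y \<in> {u..v}" for y
    proof -
      have yI: "y \<in> unit_interval" using y uv by auto
      have "?g y \<in> {?g u..?g v}"
        using y strict_mono_on_leD[OF mono uI yI] strict_mono_on_leD[OF mono yI vI] by simp
      then have "y = 2 powi k * ?g y + c" using kc g(2)[OF yI] by simp
      then have "2 powi (- k) * y = 2 powi (- k) * (2 powi k * ?g y + c)" by simp
      also have "\<dots> = (2 powi (- k) * 2 powi k) * ?g y + 2 powi (- k) * c"
        by (simp only: algebra_simps)
      also have "2 powi (- k) * 2 powi k = (1::real)"
        by (simp flip: power_int_add)
      finally show ?thesis by simp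
    qed
    then show "\<exists>(k::int) c. \<forall>y\<in>{u..v}. ?g y = 2 powi k * y + c" by blast
  qed
  moreover have "?g ` (dyadics \<inter> unit_interval) = dyadics \<inter> unit_interval"
  proof -
    have "?g ` (dyadics \<inter> unit_interval) = ?g ` (f ` (dyadics \<inter> unit_interval))"
      using f by (simp add: thompson_map_def)
    also have "\<dots> = (\<lambda>x. x) ` (dyadics \<inter> unit_interval)"
      unfolding image_image by (intro image_cong refl gf) simp
    finally show ?thesis by simp
  qed
  ultimately show ?thesis
    using f mono by (auto simp: thompson_map_def restrict_inv_into_Bij)
qed

lemma carrier_thompson_F: "carrier thompson_F = {f. thompson_map f}"
  using thompson_F_iff by blast

lemma thompson_F_eq: "thompson_F = BijGroup unit_interval\<lparr>carrier := {f. thompson_map f}\<rparr>"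
  using carrier_thompson_F unfolding thompson_F_def by simp

lemma thompson_F_group: "group thompson_F"
proof -
  interpret B: group "BijGroup unit_interval" by (rule group_BijGroup)
  have "subgroup {f. thompson_map f} (BijGroup unit_interval)"
  proof (rule B.subgroupI)
    show "{f. thompson_map f} \<subseteq> carrier (BijGroup unit_interval)"
      by (auto simp: BijGroup_def thompson_map_def)
    show "{f. thompson_map f} \<noteq> {}" using thompson_map_id by blast
    show "inv\<^bsub>BijGroup unit_interval\<^esub> f \<in> {f. thompson_map f}" if "f \<in> {f. thompson_map f}" for f
      using that thompson_map_inverse[of f] by (simp add: inv_BijGroup thompson_map_def)
    show "f \<otimes>\<^bsub>BijGroup unit_interval\<^esub> g \<in> {f. thompson_map f}"
      if "f \<in> {f. thompson_map f}" "g \<in> {f. thompson_map f}" for f g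
      using that thompson_map_compose[of g f] by (simp add: BijGroup_def thompson_map_def)
  qed
  then show ?thesis unfolding thompson_F_eq by (rule subgroup.subgroup_is_group) (rule group_BijGroup)
qed

section \<open>The action on the unit interval\<close>

interpretation F: group thompson_F by (rule thompson_F_group)

lemma thompson_F_mult_apply:
  "\<lbrakk>f \<in> carrier thompson_F; g \<in> carrier thompson_F; x \<in> unit_interval\<rbrakk>
    \<Longrightarrow> (f \<otimes>\<^bsub>thompson_F\<^esub> g) x = f (g x)"
  by (simp add: thompson_F_iff) (simp add: thompson_F_def BijGroup_def thompson_map_def compose_def)

lemma thompson_F_one_apply: "x \<in> unit_interval \<Longrightarrow> \<one>\<^bsub>thompson_F\<^esub> x = x"
  by (simp add: thompson_F_def BijGroup_def)

lemma thompson_F_mem: "\<lbrakk>f \<in> carrier thompson_F; x \<in> unit_interval\<rbrakk> \<Longrightarrow> f x \<in> unit_interval"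
  unfolding thompson_F_iff by (rule thompson_map_carrier(4))

lemma thompson_F_less_iff:
  "\<lbrakk>f \<in> carrier thompson_F; x \<in> unit_interval; y \<in> unit_interval\<rbrakk> \<Longrightarrow> f x < f y \<longleftrightarrow> x < y"
  unfolding thompson_F_iff using thompson_map_carrier(2) strict_mono_on_less by blast

lemma thompson_F_eq_iff:
  "\<lbrakk>f \<in> carrier thompson_F; x \<in> unit_interval; y \<in> unit_interval\<rbrakk> \<Longrightarrow> f x = f y \<longleftrightarrow> x = y"
  using thompson_F_less_iff by (metis linorder_neq_iff)

lemma thompson_F_inv_apply:
  assumes f: "f \<in> carrier thompson_F" and x: "x \<in> unit_interval"
  shows "(inv\<^bsub>thompson_F\<^esub> f) (f x) = x" and "f ((inv\<^bsub>thompson_F\<^esub> f) x) = x"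
  using thompson_F_mult_apply[of "inv\<^bsub>thompson_F\<^esub> f" f x]
    thompson_F_mult_apply[of f "inv\<^bsub>thompson_F\<^esub> f" x] f x
  by (simp_all add: F.l_inv F.r_inv thompson_F_one_apply)

lemma thompson_F_inv_mem:
  "\<lbrakk>f \<in> carrier thompson_F; x \<in> unit_interval\<rbrakk> \<Longrightarrow> (inv\<^bsub>thompson_F\<^esub> f) x \<in> unit_interval"
  by (rule thompson_F_mem[OF F.inv_closed])

lemma stab_F_iff: "f \<in> stab_F p \<longleftrightarrow> f \<in> carrier thompson_F \<and> f p = p"
  by (simp add: stab_F_def)

lemma stab_F_subgroup:
  assumes p: "p \<in> unit_interval" shows "subgroup (stab_F p) thompson_F"
proof (rule F.subgroupI)
  show "stab_F p \<subseteq> carrier thompson_F" by (auto simp: stab_F_def)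
  have "\<one>\<^bsub>thompson_F\<^esub> \<in> stab_F p" using p by (simp add: stab_F_iff thompson_F_one_apply)
  then show "stab_F p \<noteq> {}" by blast
  show "inv\<^bsub>thompson_F\<^esub> f \<in> stab_F p" if "f \<in> stab_F p" for f
    using that p thompson_F_inv_apply(1)[of f p] by (simp add: stab_F_iff)
  show "f \<otimes>\<^bsub>thompson_F\<^esub> g \<in> stab_F p" if "f \<in> stab_F p" "g \<in> stab_F p" for f g
    using that p by (simp add: stab_F_iff thompson_F_mult_apply)
qed

subsection \<open>Infinite orbits of point stabilizers\<close>

lemma dyadics_add: "x \<in> dyadics \<Longrightarrow> y \<in> dyadics \<Longrightarrow> x + y \<in> (dyadics :: real set)"
proof -
  assume "x \<in> dyadics" "y \<in> dyadics"
  then obtain m k n l where "x = real m / 2 ^ k" "y = real n / 2 ^ l"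
    by (auto simp: dyadics_def)
  then have "x + y = real (m * 2 ^ l + n * 2 ^ k) / 2 ^ (k + l)"
    by (simp add: add_divide_distrib power_add)
  then show ?thesis unfolding dyadics_def by blast
qed

text \<open>The order assumption keeps the numerator a natural number.\<close>

lemma dyadics_diff: "x \<in> dyadics \<Longrightarrow> y \<in> dyadics \<Longrightarrow> y \<le> x \<Longrightarrow> x - y \<in> (dyadics :: real set)"
proof -
  assume "x \<in> dyadics" "y \<in> dyadics" and yx: "y \<le> x"
  then obtain m k n l where xy: "x = real m / 2 ^ k" "y = real n / 2 ^ l"
    by (auto simp: dyadics_def)
  have "real (n * 2 ^ k) \<le> real (m * 2 ^ l)" using yx by (simp add: xy field_simps)
  then have "n * 2 ^ k \<le> m * 2 ^ l" by (simp only: of_nat_le_iff)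
  then have "x - y = real (m * 2 ^ l - n * 2 ^ k) / 2 ^ (k + l)"
    by (simp add: xy diff_divide_distrib power_add of_nat_diff)
  then show ?thesis unfolding dyadics_def by blast
qed

lemma dyadics_half: "x \<in> dyadics \<Longrightarrow> x / 2 \<in> (dyadics :: real set)"
proof -
  assume "x \<in> dyadics"
  then obtain m k where "x = real m / 2 ^ k" by (auto simp: dyadics_def)
  then have "x / 2 = real m / 2 ^ Suc k" by simp
  then show ?thesis unfolding dyadics_def by blast
qed

text \<open>A copy of the generator \<open>x\<^sub>0\<close> of \<open>F\<close>, rescaled from \<open>[0,1]\<close> to \<open>[a, a + 4u]\<close>: its slopes there
  are \<open>1/2\<close>, \<open>1\<close> and \<open>2\<close> in this order, so it is a maximum of affine maps.\<close>

definition bump :: "real \<Rightarrow> real \<Rightarrow> real \<Rightarrow> real" where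
  "bump a u x = min x (max (max ((x + a) / 2) (x - u)) (2 * x - a - 4 * u))"

text \<open>For increasing bijections of the line the inverse of a maximum is the minimum of the
  inverses, and vice versa; this is that rule applied to \<open>bump\<close>.\<close>

definition bump_inv :: "real \<Rightarrow> real \<Rightarrow> real \<Rightarrow> real" where
  "bump_inv a u y = max y (min (min (2 * y - a) (y + u)) ((y + a + 4 * u) / 2))"

lemma bump_thompson:
  assumes a: "a \<in> dyadics" "0 \<le> a" and u: "u \<in> dyadics" "0 < u" and au: "a + 4 * u \<le> 1"
  shows "(\<lambda>x\<in>unit_interval. bump a u x) \<in> carrier thompson_F"
proof -
  let ?g = "\<lambda>x\<in>unit_interval. bump a u x"
  have inverses: "bump_inv a u (bump a u x) = x" "bump a u (bump_inv a u x) = x" for x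
    using u by (auto simp: bump_def bump_inv_def min_def max_def add_divide_distrib diff_divide_distrib)
  have range: "bump a u x \<in> unit_interval" "bump_inv a u x \<in> unit_interval"
    if "x \<in> unit_interval" for x
    using that a u au by (auto simp: bump_def bump_inv_def min_def max_def)
  have bij: "bij_betw ?g unit_interval unit_interval"
    by (rule bij_betw_byWitness[where f' = "bump_inv a u"])
       (use range inverses in \<open>auto simp del: atLeastAtMost_iff\<close>)
  have mono: "strict_mono_on unit_interval ?g"
    using u by (auto simp: strict_mono_on_def bump_def min_def max_def)
  have four: "4 * u \<in> dyadics"
    using dyadics_add[OF dyadics_add[OF u(1) u(1)] dyadics_add[OF u(1) u(1)]] by simp
  have dbl: "2 * x \<in> dyadics" if "x \<in> dyadics" for x :: real
    using dyadics_add[OF that that] by simp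
  have dy: "bump a u x \<in> dyadics" if x: "x \<in> dyadics" "x \<in> unit_interval" for x
  proof -
    \<comment> \<open>\<open>dyadics\<close> has no negative elements, so the pieces that are
      differences are treated with the nonnegativity taken from the range.\<close>
    have nn: "0 \<le> bump a u x" using range(1)[OF x(2)] by simp
    have "bump a u x = x \<or> bump a u x = (x + a) / 2 \<or> bump a u x = x - u
        \<or> bump a u x = 2 * x - (a + 4 * u)"
      by (simp add: bump_def min_def max_def)
    then consider "bump a u x = x" | "bump a u x = (x + a) / 2" | "bump a u x = x - u"
      | "bump a u x = 2 * x - (a + 4 * u)" by blast
    then show ?thesis
      using nn x dyadics_half[OF dyadics_add[OF x(1) a(1)]] dyadics_diff[OF x(1) u(1)]
        dyadics_diff[OF dbl[OF x(1)] dyadics_add[OF a(1) four]] by cases (metis diff_ge_0_iff_ge)+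
  qed
  have dy': "bump_inv a u x \<in> dyadics" if x: "x \<in> dyadics" "x \<in> unit_interval" for x
  proof -
    have nn: "0 \<le> bump_inv a u x" using range(2)[OF x(2)] by simp
    have "bump_inv a u x = x \<or> bump_inv a u x = 2 * x - a \<or> bump_inv a u x = x + u
        \<or> bump_inv a u x = (x + (a + 4 * u)) / 2"
      by (simp add: bump_inv_def min_def max_def)
    then consider "bump_inv a u x = x" | "bump_inv a u x = 2 * x - a" | "bump_inv a u x = x + u"
      | "bump_inv a u x = (x + (a + 4 * u)) / 2" by blast
    then show ?thesis
      using nn x dyadics_half[OF dyadics_add[OF x(1) dyadics_add[OF a(1) four]]]
        dyadics_add[OF x(1) u(1)] dyadics_diff[OF dbl[OF x(1)] a(1)] by cases (metis diff_ge_0_iff_ge)+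
  qed
  have img: "?g ` (dyadics \<inter> unit_interval) = dyadics \<inter> unit_interval"
  proof
    show "?g ` (dyadics \<inter> unit_interval) \<subseteq> dyadics \<inter> unit_interval"
      using dy range(1) by (auto simp del: atLeastAtMost_iff)
    show "dyadics \<inter> unit_interval \<subseteq> ?g ` (dyadics \<inter> unit_interval)"
    proof
      fix y assume y: "y \<in> dyadics \<inter> unit_interval"
      then have "y = ?g (bump_inv a u y)" "bump_inv a u y \<in> dyadics \<inter> unit_interval"
        using dy' range(2) inverses(2) by (simp_all del: atLeastAtMost_iff)
      then show "y \<in> ?g ` (dyadics \<inter> unit_interval)" by blast
    qed
  qed
  \<comment> \<open>At \<open>a + 2 * u\<close> and \<open>a + 3 * u\<close> neighbouring affine
    pieces agree; at \<open>a\<close> and \<open>a + 4 * u\<close> the outer ones meet the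
    identity.\<close>
  have "dyadic_piecewise {a, a + 2 * u, a + 3 * u, a + 4 * u} ?g"
    unfolding dyadic_piecewise_def
  proof (intro conjI allI impI)
    have "2 * u \<in> dyadics" "3 * u \<in> dyadics"
      using dbl[OF u(1)] dyadics_add[OF dbl[OF u(1)] u(1)] by simp_all
    then show "{a, a + 2 * u, a + 3 * u, a + 4 * u} \<subseteq> dyadics"
      using a four by (auto intro: dyadics_add)
    fix s t :: real assume st: "0 \<le> s" "s < t" "t \<le> 1"
      and "{a, a + 2 * u, a + 3 * u, a + 4 * u} \<inter> {s<..<t} = {}"
    then have avoid: "r \<le> s \<or> t \<le> r" if "r \<in> {a, a + 2 * u, a + 3 * u, a + 4 * u}" for r
      using that by force
    have gx: "?g x = bump a u x" if "x \<in> {s..t}" for x using that st by simp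
    have piece: "\<exists>(k::int) c. \<forall>x\<in>{s..t}. ?g x = 2 powi k * x + c"
      if "\<And>x. x \<in> {s..t} \<Longrightarrow> bump a u x = 2 powi k * x + c" for k :: int and c
      using that gx by metis
    consider "t \<le> a" | "a \<le> s" "t \<le> a + 2 * u" | "a + 2 * u \<le> s" "t \<le> a + 3 * u"
      | "a + 3 * u \<le> s" "t \<le> a + 4 * u" | "a + 4 * u \<le> s"
      using avoid[of a] avoid[of "a + 2 * u"] avoid[of "a + 3 * u"] avoid[of "a + 4 * u"] by auto
    then show "\<exists>(k::int) c. \<forall>x\<in>{s..t}. ?g x = 2 powi k * x + c"
    proof cases
      case 1
      then show ?thesis
        using u by (intro piece[of 0 0]) (auto simp: bump_def min_def max_def)
    next
      case 2
      then show ?thesis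
        using u by (intro piece[of "-1" "a / 2"])
          (auto simp: bump_def min_def max_def power_int_minus field_simps)
    next
      case 3
      then show ?thesis
        using u by (intro piece[of 0 "- u"]) (auto simp: bump_def min_def max_def)
    next
      case 4
      then show ?thesis
        using u by (intro piece[of 1 "- a - 4 * u"]) (auto simp: bump_def min_def max_def)
    next
      case 5
      then show ?thesis
        using u by (intro piece[of 0 0]) (auto simp: bump_def min_def max_def)
    qed
  qed simp
  then show ?thesis
    using bij mono img by (auto simp: thompson_F_iff thompson_map_def Bij_def)
qed

text \<open>A \<open>bump\<close> with \<open>r\<close> inside its support, on a dyadic grid so fine
  that the support, being shorter than the distance from \<open>r\<close> to \<open>p\<close>,
  leaves \<open>p\<close> fixed.\<close>

lemma stab_F_moves_point:
  assumes r: "r \<in> {0<..<1}" and p: "p \<in> unit_interval" and rp: "r \<noteq> p"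
  obtains g where "g \<in> stab_F p" "g r < r" "\<And>x. x \<in> unit_interval \<Longrightarrow> g x \<le> x"
proof -
  \<comment> \<open>The three terms keep the support away from \<open>p\<close>, to the right of
    \<open>0\<close> and to the left of \<open>1\<close>.\<close>
  define e where "e = min \<bar>r - p\<bar> (min r (1 - r))"
  have e: "0 < e" using r rp by (simp add: e_def)
  obtain n where n: "(1/2) ^ n < e / 4"
    using real_arch_pow_inv[of "e / 4" "1/2"] e by auto
  define u :: real where "u = (1/2) ^ n"
  have u: "0 < u" "4 * u < e" using n by (auto simp: u_def)
  define j where "j = nat \<lfloor>r / u\<rfloor>"
  have j: "real j * u \<le> r" "r < (real j + 1) * u"
  proof -
    have "real j = of_int \<lfloor>r / u\<rfloor>" using r u by (simp add: j_def)
    then have "real j \<le> r / u" "r / u < real j + 1" by linarith+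
    then show "real j * u \<le> r" "r < (real j + 1) * u" using u by (simp_all add: field_simps)
  qed
  have ur: "u \<le> r" "3 * u \<le> 1 - r" "4 * u < \<bar>r - p\<bar>" using u e by (auto simp: e_def)
  have j1: "1 \<le> j"
  proof (rule ccontr)
    assume "\<not> 1 \<le> j"
    then have "j = 0" by simp
    then show False using j ur by simp
  qed
  \<comment> \<open>One grid step below the cell of \<open>r\<close>, so that \<open>r\<close> is
    strictly inside the support even when it is a grid point; \<open>j1\<close> keeps
    \<open>a\<close> nonnegative.\<close>
  define a where "a = real (j - 1) * u"
  have a: "a + u \<le> r" "r < a + 2 * u" "0 \<le> a"
    using j j1 u by (auto simp: a_def of_nat_diff algebra_simps)
  have "u = of_nat 1 / 2 ^ n" by (simp add: u_def power_divide)
  then have ud: "u \<in> dyadics" unfolding dyadics_def by blast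
  have "a = of_nat (j - 1) / 2 ^ n" by (simp add: a_def u_def power_divide)
  then have ad: "a \<in> dyadics" unfolding dyadics_def by blast
  show thesis
  proof
    show "(\<lambda>x\<in>unit_interval. bump a u x) \<in> stab_F p"
      unfolding stab_F_iff
    proof
      show "(\<lambda>x\<in>unit_interval. bump a u x) \<in> carrier thompson_F"
        using a ur by (intro bump_thompson ad ud u) auto
      have "p \<le> a \<or> a + 4 * u \<le> p" using ur a by linarith
      then show "(\<lambda>x\<in>unit_interval. bump a u x) p = p"
        using p u by (auto simp: bump_def min_def max_def)
    qed
    show "(\<lambda>x\<in>unit_interval. bump a u x) r < r"
      using r u a by (auto simp: bump_def min_def max_def)
    show "(\<lambda>x\<in>unit_interval. bump a u x) x \<le> x" if "x \<in> unit_interval" for x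
      using that by (auto simp: bump_def)
  qed
qed

lemma thompson_F_pow_apply:
  assumes g: "g \<in> carrier thompson_F" and x: "x \<in> unit_interval"
  shows "(g [^]\<^bsub>thompson_F\<^esub> (n::nat)) x = (g ^^ n) x"
  using x
proof (induction n arbitrary: x)
  case (Suc n)
  then show ?case
    using g thompson_F_mem[OF g Suc(2)]
    by (simp add: thompson_F_mult_apply funpow_swap1)
qed (simp add: thompson_F_one_apply)

text \<open>The preimage of an end point cannot lie beyond that end point. This keeps preimages of
  interior points interior.\<close>

lemma thompson_F_end_points:
  assumes f: "f \<in> carrier thompson_F" shows "f 0 = 0" and "f 1 = 1"
proof -
  have inv: "(inv\<^bsub>thompson_F\<^esub> f) x \<in> unit_interval" if "x \<in> unit_interval" for x
    by (rule thompson_F_inv_mem[OF f that])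
  have "\<not> 0 < f 0"
    using thompson_F_less_iff[OF f inv[of 0], of 0] thompson_F_inv_apply(2)[OF f, of 0] inv[of 0] by simp
  then show "f 0 = 0" using thompson_F_mem[OF f, of 0] by simp
  have "\<not> f 1 < 1"
    using thompson_F_less_iff[OF f, of 1 "(inv\<^bsub>thompson_F\<^esub> f) 1"] thompson_F_inv_apply(2)[OF f, of 1]
      inv[of 1] by simp
  then show "f 1 = 1" using thompson_F_mem[OF f, of 1] by simp
qed

text \<open>A coset of \<open>stab_F q\<close> is determined by the point that its elements send to
  \<open>q\<close>. For \<open>x\<close> times the \<open>n\<close>-th power of \<open>g\<close>
  this point is the image of \<open>r\<close> under the inverse power. These points are distinct for
  different \<open>n\<close>, because \<open>g\<close> never moves a point up and moves
  \<open>r\<close> down.\<close>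

lemma stab_F_infinite_orbit:
  assumes p: "p \<in> {0<..<1}" and q: "q \<in> {0<..<1}"
    and x: "x \<in> carrier thompson_F" and xp: "x p \<noteq> q"
  shows "infinite ((\<lambda>h. stab_F q #>\<^bsub>thompson_F\<^esub> (x \<otimes>\<^bsub>thompson_F\<^esub> h)) ` stab_F p)"
proof -
  have pI: "p \<in> unit_interval" and qI: "q \<in> unit_interval" using p q by auto
  define r where "r = (inv\<^bsub>thompson_F\<^esub> x) q"
  have rI: "r \<in> unit_interval" unfolding r_def by (rule thompson_F_inv_mem[OF x qI])
  have xr: "x r = q" unfolding r_def by (rule thompson_F_inv_apply(2)[OF x qI])
  have "r \<noteq> 0" "r \<noteq> 1" "r \<noteq> p" using thompson_F_end_points[OF x] xr q xp by auto
  then have "r \<in> {0<..<1}" using rI by auto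
  then obtain g where gs: "g \<in> stab_F p" and gr: "g r < r"
    and gle: "\<And>z. z \<in> unit_interval \<Longrightarrow> g z \<le> z"
    using stab_F_moves_point[OF _ pI \<open>r \<noteq> p\<close>] by metis
  have g: "g \<in> carrier thompson_F" using gs by (simp add: stab_F_iff)
  interpret P: subgroup "stab_F p" thompson_F by (rule stab_F_subgroup[OF pI])
  interpret Q: subgroup "stab_F q" thompson_F by (rule stab_F_subgroup[OF qI])
  define gp where "gp n = g [^]\<^bsub>thompson_F\<^esub> (n::nat)" for n
  have gp: "gp n \<in> carrier thompson_F" for n using g by (simp add: gp_def)
  have gps: "gp n \<in> stab_F p" for n
    unfolding gp_def by (induction n) (simp_all add: P.one_closed P.m_closed gs)
  have gp_apply: "gp n z = (g ^^ n) z" if "z \<in> unit_interval" for n z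
    using that g by (simp only: gp_def thompson_F_pow_apply)
  have neq: "stab_F q #>\<^bsub>thompson_F\<^esub> (x \<otimes>\<^bsub>thompson_F\<^esub> gp n)
      \<noteq> stab_F q #>\<^bsub>thompson_F\<^esub> (x \<otimes>\<^bsub>thompson_F\<^esub> gp m)" if nm: "n < m" for n m
  proof
    assume eq: "stab_F q #>\<^bsub>thompson_F\<^esub> (x \<otimes>\<^bsub>thompson_F\<^esub> gp n)
      = stab_F q #>\<^bsub>thompson_F\<^esub> (x \<otimes>\<^bsub>thompson_F\<^esub> gp m)"
    have "x \<otimes>\<^bsub>thompson_F\<^esub> gp m \<in> stab_F q #>\<^bsub>thompson_F\<^esub> (x \<otimes>\<^bsub>thompson_F\<^esub> gp n)"
      unfolding eq using x gp by (intro F.rcos_self Q.subgroup_axioms) simp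
    then obtain h where h: "h \<in> stab_F q" and
      hx: "x \<otimes>\<^bsub>thompson_F\<^esub> gp m = h \<otimes>\<^bsub>thompson_F\<^esub> (x \<otimes>\<^bsub>thompson_F\<^esub> gp n)"
      by (auto simp: r_coset_def)
    \<comment> \<open>The point that \<open>x\<close> times \<open>gp n\<close> sends to
      \<open>q\<close>; equality of the cosets makes \<open>x\<close> times \<open>gp m\<close> send
      it to \<open>q\<close> as well.\<close>
    define z where "z = (inv\<^bsub>thompson_F\<^esub> (gp n)) r"
    have z: "z \<in> unit_interval" unfolding z_def by (rule thompson_F_inv_mem[OF gp rI])
    have gz: "gp n z = r" unfolding z_def by (rule thompson_F_inv_apply(2)[OF gp rI])
    have gI: "gp k y \<in> unit_interval" if "y \<in> unit_interval" for k y
      by (rule thompson_F_mem[OF gp that])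
    have "x (gp m z) = h (x (gp n z))"
    proof -
      have hF: "h \<in> carrier thompson_F" by (rule Q.mem_carrier[OF h])
      show ?thesis
        using arg_cong[OF hx, of "\<lambda>f. f z"]
        by (simp only: thompson_F_mult_apply[OF x gp z] thompson_F_mult_apply[OF hF F.m_closed[OF x gp] z])
    qed
    also have "\<dots> = x (gp n z)" using h unfolding gz xr stab_F_iff by simp
    finally have "gp m z = gp n z" using thompson_F_eq_iff[OF x gI[OF z] gI[OF z]] by simp
    moreover have "gp m z = gp n (gp (m - n) z)"
      using nm gI z by (simp add: gp_apply del: atLeastAtMost_iff flip: funpow_add[THEN fun_cong, unfolded o_apply])
    ultimately have fixed: "gp (m - n) z = z" using thompson_F_eq_iff[OF gp gI[OF z] z] by simp
    \<comment> \<open>A fixed point of \<open>g\<close> is fixed by \<open>gp n\<close>, so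
      \<open>z\<close> would be \<open>r\<close>, which \<open>g\<close> moves.\<close>
    have "g z \<noteq> z"
    proof
      assume "g z = z"
      then have "(g ^^ n) z = z" by (induction n) simp_all
      then show False using \<open>g z = z\<close> gr gz gp_apply[OF z] by simp
    qed
    then have gzz: "g z < z" using gle[OF z] by simp
    have "gp k y \<le> y" if "y \<in> unit_interval" for k y
      using that
    proof (induction k)
      case (Suc k)
      then show ?case
        using gle[of "(g ^^ k) y"] gI[of y k] by (simp add: gp_apply del: atLeastAtMost_iff)
    qed (simp add: gp_apply del: atLeastAtMost_iff)
    moreover have "gp (Suc k) z = gp k (g z)" for k
      using z thompson_F_mem[OF g z] by (simp add: gp_apply funpow_swap1 del: atLeastAtMost_iff)
    \<comment> \<open>One strictly decreasing step, followed by steps that never increase, cannot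
      return to \<open>z\<close>.\<close>
    ultimately have "gp (Suc k) z < z" for k
      using gzz thompson_F_mem[OF g z] by (metis order.strict_trans1)
    then show False using fixed nm by (metis Suc_diff_Suc less_irrefl)
  qed
  have "inj (\<lambda>n. stab_F q #>\<^bsub>thompson_F\<^esub> (x \<otimes>\<^bsub>thompson_F\<^esub> gp n))"
    by (rule injI) (metis neq linorder_neq_iff)
  then have "infinite (range (\<lambda>n. stab_F q #>\<^bsub>thompson_F\<^esub> (x \<otimes>\<^bsub>thompson_F\<^esub> gp n)))"
    by (simp add: finite_image_iff)
  then show ?thesis
    by (rule infinite_super[rotated]) (use gps in auto)
qed

section \<open>Representations induced from point stabilizers\<close>

lemma stab_F_induced_rep:
  assumes p: "p \<in> unit_interval" and irr: "irreducible_rep (stab_group p) V \<sigma>"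
  shows "induced_rep thompson_F V (stab_F p) \<sigma>"
proof -
  have "hilbert_space V" "\<sigma> \<in> hom (thompson_F\<lparr>carrier := stab_F p\<rparr>) (unitary_group V)"
    using irr by (simp_all add: irreducible_rep_def unitary_rep_def stab_group_def)
  then show ?thesis
    by (intro induced_rep.intro induced_rep_axioms.intro thompson_F_group stab_F_subgroup p)
qed

lemma stab_F_ind_rep_irreducible:
  assumes p: "p \<in> {0<..<1}" and irr: "irreducible_rep (stab_group p) V \<sigma>"
    and fd: "finite_dimensional V"
  shows "irreducible_rep thompson_F (ind_space thompson_F (stab_F p) V \<sigma>)
    (ind_rep thompson_F (stab_F p) V \<sigma>)"
proof -
  interpret induced_rep thompson_F V "stab_F p" \<sigma>
    by (rule stab_F_induced_rep[OF _ irr]) (use p in simp)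
  show ?thesis
  proof (rule ind_rep_irreducible[OF _ fd])
    show "irreducible_rep (thompson_F\<lparr>carrier := stab_F p\<rparr>) V \<sigma>"
      using irr by (simp add: stab_group_def)
    fix x assume "x \<in> carrier thompson_F" "x \<notin> stab_F p"
    then show "infinite ((\<lambda>h. stab_F p #>\<^bsub>thompson_F\<^esub> (x \<otimes>\<^bsub>thompson_F\<^esub> h)) ` stab_F p)"
      by (intro stab_F_infinite_orbit p) (auto simp: stab_F_iff)
  qed
qed

lemma stab_F_conjugate:
  assumes p: "p \<in> unit_interval" and c: "c \<in> carrier thompson_F"
  shows "h \<in> stab_F p \<Longrightarrow> c \<otimes>\<^bsub>thompson_F\<^esub> h \<otimes>\<^bsub>thompson_F\<^esub> inv\<^bsub>thompson_F\<^esub> c \<in> stab_F (c p)"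
    and "k \<in> stab_F (c p) \<Longrightarrow> inv\<^bsub>thompson_F\<^esub> c \<otimes>\<^bsub>thompson_F\<^esub> k \<otimes>\<^bsub>thompson_F\<^esub> c \<in> stab_F p"
  using thompson_F_mem[OF c p] p c thompson_F_inv_mem[OF c thompson_F_mem[OF c p]]
  by (simp_all add: stab_F_iff thompson_F_mult_apply thompson_F_inv_apply del: atLeastAtMost_iff)

text \<open>Off this coset \<open>x p\<close> differs from \<open>c p\<close>, which is what
  \<open>stab_F_infinite_orbit\<close> asks for.\<close>

lemma stab_F_coset_iff:
  assumes p: "p \<in> unit_interval" and c: "c \<in> carrier thompson_F" and x: "x \<in> carrier thompson_F"
  shows "x \<in> stab_F (c p) #>\<^bsub>thompson_F\<^esub> c \<longleftrightarrow> x p = c p"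
proof -
  have cp: "c p \<in> unit_interval" by (rule thompson_F_mem[OF c p])
  have "x \<in> stab_F (c p) #>\<^bsub>thompson_F\<^esub> c
      \<longleftrightarrow> x \<otimes>\<^bsub>thompson_F\<^esub> inv\<^bsub>thompson_F\<^esub> c \<in> stab_F (c p)"
    by (rule subgroup.rcos_module[OF stab_F_subgroup[OF cp] thompson_F_group c x])
  also have "\<dots> \<longleftrightarrow> x p = c p"
    using x c p cp
    by (simp add: stab_F_iff thompson_F_mult_apply thompson_F_inv_apply del: atLeastAtMost_iff)
  finally show ?thesis .
qed

theorem proposition9:
  fixes p q :: real
    and V\<^sub>p :: "'v::complex_vector hspace" and \<sigma>\<^sub>p :: "(real \<Rightarrow> real) \<Rightarrow> 'v \<Rightarrow> 'v"
    and V\<^sub>q :: "'w::complex_vector hspace" and \<sigma>\<^sub>q :: "(real \<Rightarrow> real) \<Rightarrow> 'w \<Rightarrow> 'w"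
  assumes "p \<in> {0<..<1}" and "q \<in> {0<..<1}"
    and "irreducible_rep (stab_group p) V\<^sub>p \<sigma>\<^sub>p" and "finite_dimensional V\<^sub>p"
    and "irreducible_rep (stab_group q) V\<^sub>q \<sigma>\<^sub>q" and "finite_dimensional V\<^sub>q"
  shows "irreducible_rep thompson_F
           (ind_space thompson_F (stab_F p) V\<^sub>p \<sigma>\<^sub>p) (ind_rep thompson_F (stab_F p) V\<^sub>p \<sigma>\<^sub>p) \<and>
         irreducible_rep thompson_F
           (ind_space thompson_F (stab_F q) V\<^sub>q \<sigma>\<^sub>q) (ind_rep thompson_F (stab_F q) V\<^sub>q \<sigma>\<^sub>q) \<and>
         (equivalent_reps thompson_F
            (ind_space thompson_F (stab_F p) V\<^sub>p \<sigma>\<^sub>p) (ind_rep thompson_F (stab_F p) V\<^sub>p \<sigma>\<^sub>p)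
            (ind_space thompson_F (stab_F q) V\<^sub>q \<sigma>\<^sub>q) (ind_rep thompson_F (stab_F q) V\<^sub>q \<sigma>\<^sub>q)
          \<longleftrightarrow>
          (\<exists>\<gamma>\<in>carrier thompson_F. q = \<gamma> p \<and>
             equivalent_reps (stab_group p) V\<^sub>p \<sigma>\<^sub>p V\<^sub>q (conj_rep thompson_F \<gamma> \<sigma>\<^sub>q)))"
proof (intro conjI iffI)
  have p: "p \<in> unit_interval" and q: "q \<in> unit_interval" using assms(1,2) by auto
  note Ap = stab_F_induced_rep[OF p assms(3)] and Aq = stab_F_induced_rep[OF q assms(5)]
  show "irreducible_rep thompson_F
      (ind_space thompson_F (stab_F p) V\<^sub>p \<sigma>\<^sub>p) (ind_rep thompson_F (stab_F p) V\<^sub>p \<sigma>\<^sub>p)"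
    by (rule stab_F_ind_rep_irreducible[OF assms(1,3,4)])
  show "irreducible_rep thompson_F
      (ind_space thompson_F (stab_F q) V\<^sub>q \<sigma>\<^sub>q) (ind_rep thompson_F (stab_F q) V\<^sub>q \<sigma>\<^sub>q)"
    by (rule stab_F_ind_rep_irreducible[OF assms(2,5,6)])
  show "\<exists>\<gamma>\<in>carrier thompson_F. q = \<gamma> p \<and>
      equivalent_reps (stab_group p) V\<^sub>p \<sigma>\<^sub>p V\<^sub>q (conj_rep thompson_F \<gamma> \<sigma>\<^sub>q)"
    if eq: "equivalent_reps thompson_F
      (ind_space thompson_F (stab_F p) V\<^sub>p \<sigma>\<^sub>p) (ind_rep thompson_F (stab_F p) V\<^sub>p \<sigma>\<^sub>p)
      (ind_space thompson_F (stab_F q) V\<^sub>q \<sigma>\<^sub>q) (ind_rep thompson_F (stab_F q) V\<^sub>q \<sigma>\<^sub>q)"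
  proof -
    obtain T where T: "intertwiner thompson_F V\<^sub>p (stab_F p) \<sigma>\<^sub>p V\<^sub>q (stab_F q) \<sigma>\<^sub>q T"
      and iso: "\<And>v w. \<lbrakk>v \<in> carrier V\<^sub>p; w \<in> carrier V\<^sub>p\<rbrakk>
        \<Longrightarrow> cinner (ind_space thompson_F (stab_F q) V\<^sub>q \<sigma>\<^sub>q) (T v) (T w) = cinner V\<^sub>p v w"
      using intertwiner_of_equivalence[OF Ap Aq assms(4) eq] by blast
    interpret T: intertwiner thompson_F V\<^sub>p "stab_F p" \<sigma>\<^sub>p V\<^sub>q "stab_F q" \<sigma>\<^sub>q T by (rule T)
    have nz: "carrier V\<^sub>p \<noteq> {0}" using assms(3) by (simp add: irreducible_rep_def)
    note orbit = stab_F_infinite_orbit[OF assms(1,2)]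
    \<comment> \<open>If no element moved \<open>p\<close> to \<open>q\<close>, every orbit would be
      infinite.\<close>
    obtain \<gamma> where \<gamma>: "\<gamma> \<in> carrier thompson_F" "q = \<gamma> p"
      using T.not_all_orbits_infinite[OF iso nz] orbit by metis
    have "equivalent_reps (thompson_F\<lparr>carrier := stab_F p\<rparr>) V\<^sub>p \<sigma>\<^sub>p V\<^sub>q (conj_rep thompson_F \<gamma> \<sigma>\<^sub>q)"
    proof (rule T.equivalent_conjugate[OF iso nz \<gamma>(1)])
      show "irreducible_rep (thompson_F\<lparr>carrier := stab_F q\<rparr>) V\<^sub>q \<sigma>\<^sub>q"
        using assms(5) by (simp add: stab_group_def)
      show "infinite ((\<lambda>h. stab_F q #>\<^bsub>thompson_F\<^esub> (x \<otimes>\<^bsub>thompson_F\<^esub> h)) ` stab_F p)"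
        if "x \<in> carrier thompson_F" "x \<notin> stab_F q #>\<^bsub>thompson_F\<^esub> \<gamma>" for x
        using that stab_F_coset_iff[OF p \<gamma>(1)] \<gamma>(2) by (intro orbit) auto
    qed (use stab_F_conjugate[OF p \<gamma>(1)] \<gamma>(2) assms(6) in simp_all)
    then show ?thesis using \<gamma> unfolding stab_group_def by blast
  qed
  show "equivalent_reps thompson_F
      (ind_space thompson_F (stab_F p) V\<^sub>p \<sigma>\<^sub>p) (ind_rep thompson_F (stab_F p) V\<^sub>p \<sigma>\<^sub>p)
      (ind_space thompson_F (stab_F q) V\<^sub>q \<sigma>\<^sub>q) (ind_rep thompson_F (stab_F q) V\<^sub>q \<sigma>\<^sub>q)"
    if "\<exists>\<gamma>\<in>carrier thompson_F. q = \<gamma> p \<and>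
      equivalent_reps (stab_group p) V\<^sub>p \<sigma>\<^sub>p V\<^sub>q (conj_rep thompson_F \<gamma> \<sigma>\<^sub>q)"
  proof -
    from that obtain \<gamma> where \<gamma>: "\<gamma> \<in> carrier thompson_F" "q = \<gamma> p"
      and eq: "equivalent_reps (stab_group p) V\<^sub>p \<sigma>\<^sub>p V\<^sub>q (conj_rep thompson_F \<gamma> \<sigma>\<^sub>q)"
      by (elim bexE conjE)
    show ?thesis
      using stab_F_conjugate[OF p \<gamma>(1)] \<gamma>(2)
      by (intro conjugate_induced_equivalent[OF Ap Aq \<gamma>(1) _ _ eq[unfolded stab_group_def]]) simp_all
  qed
qed

end
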